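(* Let $(X,S)$ be a non-degenerate, involutive and braided "set-theoretical" solution of the quantum Yang-Baxter equation, where $X$ is a finite set, and let $G$ be the structure group of $(X,S)$. Then $G$ is a Garside group. Conversely, let $M=\operatorname{Mon}\langle X\mid R\rangle$ be a Garside monoid such that: 1) $X=\{x_1,\dots,x_n\}$; 2) there are $n(n-1)/2$ defining relations in $R$; 3) each side of a relation in $R$ has length $2$; 4) if a word $x_ix_j$ appears in $R$ (as a side of a relation), then it appears only once. Then there exists a function $S:X\times X\to X\times X$ such that $(X,S)$ is a non-degenerate, involutive and braided "set-theoretical" solution and $G=\operatorname{Gp}\langle X\mid R\rangle$ is the structure group of $(X,S)$.
   Context: Solutions. Let $X$ be a non-empty set and $S:X\times X\to X\times X$ a bijection, written $S(x,y)=(g_x(y),f_y(x))$. The pair $(X,S)$ is called non-degenerate if all the maps $f_x,g_x:X\to X$ ($x\in X$) are bijective; involutive if $S^2=\mathrm{id}$; braided if $S^{12}S^{23}S^{12}=S^{23}S^{12}S^{23}$ on $X^3$, where $S^{12}=S\times \mathrm{id}_X$ and $S^{23}=\mathrm{id}_X\times S$. A "set-theoretical" solution of the quantum Yang-Baxter equation is such a (braided) pair $(X,S)$. The structure group of $(X,S)$ is the group generated by the elements of $X$ with defining relations $xy=tz$ whenever $S(x,y)=(t,z)$. Garside monoids and groups. Let $M$ be a monoid. $x$ is a left (resp. right) divisor of $z$ if $z=xt$ (resp. $z=tx$) for some $t\in M$. A right lcm of $x,y$ is an element $z$ that has $x,y$ as left divisors and is a left divisor of every $w$ having $x,y$ as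 left divisors; a left gcd of $x,y$ is a common left divisor that every common left divisor left-divides. Left lcm and right gcd are defined symmetrically. An atom is an element $x\neq 1$ such that $x=yz$ implies $y=1$ or $z=1$. $M$ is atomic if it is generated by its atoms and, for each $x\in M$, the supremum of the lengths of decompositions of $x$ into products of atoms is finite. $M$ is Gaussian if it is atomic, left and right cancellative, and any two elements have a left and a right gcd and a left and a right lcm. An element $\Delta\in M$ is a Garside element if its left divisors coincide with its right divisors, there are finitely many of them, and they generate $M$. $M$ is Garside if it is Gaussian and contains a Garside element. A group is a Garside group if it is the group of fractions of a Garside monoid. $\operatorname{Mon}\langle X\mid R\rangle$ and $\operatorname{Gp}\langle X\mid R\rangle$ denote the monoid and the group with generators $X$ and defining relations $R$. *)

theory Defs
  imports "HOL-Algebra.Divisibility"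
begin

section \<open>Presentations\<close>

text \<open>The congruence on the free monoid of words over \<open>X\<close> generated by the pairs in \<open>R\<close>;
  pairs that are not words over \<open>X\<close> are ignored.\<close>

inductive_set word_cong :: "'a set \<Rightarrow> ('a list \<times> 'a list) set \<Rightarrow> ('a list \<times> 'a list) set"
  for X :: "'a set" and R :: "('a list \<times> 'a list) set"
where
  refl: "w \<in> lists X \<Longrightarrow> (w, w) \<in> word_cong X R"
| rel: "\<lbrakk>(u, v) \<in> R; u \<in> lists X; v \<in> lists X; p \<in> lists X; q \<in> lists X\<rbrakk>
    \<Longrightarrow> (p @ u @ q, p @ v @ q) \<in> word_cong X R"
| sym: "(u, v) \<in> word_cong X R \<Longrightarrow> (v, u) \<in> word_cong X R"
| trans: "\<lbrakk>(u, v) \<in> word_cong X R; (v, w) \<in> word_cong X R\<rbrakk> \<Longrightarrow> (u, w) \<in> word_cong X R"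

definition presented_monoid :: "'a set \<Rightarrow> ('a list \<times> 'a list) set \<Rightarrow> 'a list set monoid" where
  "presented_monoid X R =
    \<lparr>carrier = lists X // word_cong X R,
     mult = (\<lambda>A B. \<Union>u\<in>A. \<Union>v\<in>B. word_cong X R `` {u @ v}),
     one = word_cong X R `` {[]}\<rparr>"

text \<open>Group words are words in the letters \<open>(x, True)\<close>, standing for \<open>x\<close>, and \<open>(x, False)\<close>,
  standing for the formal inverse of \<open>x\<close>.\<close>

definition group_relations ::
    "'a set \<Rightarrow> ('a list \<times> 'a list) set \<Rightarrow> (('a \<times> bool) list \<times> ('a \<times> bool) list) set" where
  "group_relations X R =
    (\<lambda>(u, v). (map (\<lambda>x. (x, True)) u, map (\<lambda>x. (x, True)) v)) ` R
    \<union> {([(x, b), (x, \<not> b)], []) | x b. x \<in> X}"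

definition presented_group ::
    "'a set \<Rightarrow> ('a list \<times> 'a list) set \<Rightarrow> ('a \<times> bool) list set monoid" where
  "presented_group X R = presented_monoid (X \<times> UNIV) (group_relations X R)"

lemma word_cong_lists: "(u, v) \<in> word_cong X R \<Longrightarrow> u \<in> lists X \<and> v \<in> lists X"
  by (induction rule: word_cong.induct) auto

lemma equiv_word_cong: "equiv (lists X) (word_cong X R)"
  by (rule equivI)
    (auto intro!: refl_onI symI transI dest: word_cong_lists
      intro: word_cong.refl word_cong.sym word_cong.trans)

lemma word_cong_context:
  assumes "(u, v) \<in> word_cong X R" "p \<in> lists X" "q \<in> lists X"
  shows "(p @ u @ q, p @ v @ q) \<in> word_cong X R"
  using assms
proof (induction rule: word_cong.induct)
  case (refl w)
  then have "p @ w @ q \<in> lists X" by simp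
  then show ?case by (rule word_cong.refl)
next
  case (rel u v p' q')
  then show ?case using word_cong.rel[of u v R X "p @ p'" "q' @ q"] by auto
next
  case (sym u v)
  then show ?case by (auto intro: word_cong.sym)
next
  case (trans u v w)
  then show ?case by (blast intro: word_cong.trans)
qed

lemma word_cong_append:
  assumes "(u, u') \<in> word_cong X R" "(v, v') \<in> word_cong X R"
  shows "(u @ v, u' @ v') \<in> word_cong X R"
proof -
  have "([] @ u @ v, [] @ u' @ v) \<in> word_cong X R" 
    using assms word_cong_lists by (intro word_cong_context) blast+
  moreover have "(u' @ v @ [], u' @ v' @ []) \<in> word_cong X R" 
    using assms word_cong_lists by (intro word_cong_context) blast+
  ultimately show ?thesis by (auto intro: word_cong.trans)
qed

lemma presented_monoid_mult:
  assumes "u \<in> lists X" "v \<in> lists X"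
  shows "word_cong X R `` {u} \<otimes>\<^bsub>presented_monoid X R\<^esub> word_cong X R `` {v}
    = word_cong X R `` {u @ v}"
proof -
  have "word_cong X R `` {u' @ v'} = word_cong X R `` {u @ v}"
    if "(u, u') \<in> word_cong X R" "(v, v') \<in> word_cong X R" for u' v'
    using equiv_class_eq[OF equiv_word_cong word_cong_append[OF that]] by simp
  then show ?thesis
    using assms by (auto simp: presented_monoid_def intro: word_cong.refl)
qed

lemma presented_monoid_carrierE:
  assumes "A \<in> carrier (presented_monoid X R)"
  obtains u where "u \<in> lists X" "A = word_cong X R `` {u}"
  using assms that unfolding presented_monoid_def by (auto elim!: quotientE simp del: in_lists_conv_set)

lemma presented_monoid_carrierI:
  "u \<in> lists X \<Longrightarrow> word_cong X R `` {u} \<in> carrier (presented_monoid X R)"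
  by (auto simp: presented_monoid_def intro: quotientI)

lemma monoid_presented_monoid: "monoid (presented_monoid X R)"
proof -
  have one: "\<one>\<^bsub>presented_monoid X R\<^esub> = word_cong X R `` {[]}"
    by (simp add: presented_monoid_def)
  show ?thesis
  proof (rule monoidI)
    fix A B assume "A \<in> carrier (presented_monoid X R)" "B \<in> carrier (presented_monoid X R)"
    then show "A \<otimes>\<^bsub>presented_monoid X R\<^esub> B \<in> carrier (presented_monoid X R)"
      by (elim presented_monoid_carrierE)
        (simp only: presented_monoid_mult presented_monoid_carrierI append_in_lists_conv simp_thms)
  next
    show "\<one>\<^bsub>presented_monoid X R\<^esub> \<in> carrier (presented_monoid X R)"
      by (simp add: one presented_monoid_carrierI)
  next
    fix A B C assume "A \<in> carrier (presented_monoid X R)"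
      "B \<in> carrier (presented_monoid X R)" "C \<in> carrier (presented_monoid X R)"
    then show "A \<otimes>\<^bsub>presented_monoid X R\<^esub> B \<otimes>\<^bsub>presented_monoid X R\<^esub> C
      = A \<otimes>\<^bsub>presented_monoid X R\<^esub> (B \<otimes>\<^bsub>presented_monoid X R\<^esub> C)"
      by (elim presented_monoid_carrierE)
        (simp only: presented_monoid_mult append_in_lists_conv append_assoc simp_thms)
  next
    fix A assume "A \<in> carrier (presented_monoid X R)"
    then show "\<one>\<^bsub>presented_monoid X R\<^esub> \<otimes>\<^bsub>presented_monoid X R\<^esub> A = A"
      by (elim presented_monoid_carrierE)
        (simp only: one presented_monoid_mult lists.Nil append_Nil)
  next
    fix A assume "A \<in> carrier (presented_monoid X R)"
    then show "A \<otimes>\<^bsub>presented_monoid X R\<^esub> \<one>\<^bsub>presented_monoid X R\<^esub> = A"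
      by (elim presented_monoid_carrierE)
        (simp only: one presented_monoid_mult lists.Nil append_Nil2)
  qed
qed

lemma group_presented_group: "group (presented_group X R)"
proof -
  let ?Y = "X \<times> (UNIV :: bool set)" and ?R = "group_relations X R"
  let ?c = "\<lambda>w. word_cong ?Y ?R `` {w}"
  interpret monoid "presented_monoid ?Y ?R" by (rule monoid_presented_monoid)
  have one: "\<one>\<^bsub>presented_monoid ?Y ?R\<^esub> = ?c []"
    by (simp add: presented_monoid_def)
  have "\<exists>v \<in> lists ?Y. (v @ w, []) \<in> word_cong ?Y ?R" if "w \<in> lists ?Y" for w
    using that
  proof (induction w)
    case Nil
    show ?case by (rule bexI[of _ "[]"]) (auto intro: word_cong.refl)
  next
    case (Cons a w)
    obtain x b where a: "a = (x, b)" "x \<in> X" using Cons.hyps by auto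
    obtain v where v: "v \<in> lists ?Y" "(v @ w, []) \<in> word_cong ?Y ?R" using Cons by auto
    have "([(x, \<not> b), (x, b)], []) \<in> ?R"
      using a(2) by (auto simp: group_relations_def)
    then have "(v @ [(x, \<not> b), (x, b)] @ w, v @ [] @ w) \<in> word_cong ?Y ?R"
      using a v Cons.hyps by (intro word_cong.rel) auto
    then have "((v @ [(x, \<not> b)]) @ a # w, []) \<in> word_cong ?Y ?R"
      using v(2) a by (auto intro: word_cong.trans)
    then show ?case using v(1) a(2) by (intro bexI[of _ "v @ [(x, \<not> b)]"]) auto
  qed
  note left_inverse = this
  have "\<exists>B \<in> carrier (presented_monoid ?Y ?R).
      B \<otimes>\<^bsub>presented_monoid ?Y ?R\<^esub> A = \<one>\<^bsub>presented_monoid ?Y ?R\<^esub>"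
    if A: "A \<in> carrier (presented_monoid ?Y ?R)" for A
  proof -
    obtain w where w: "w \<in> lists ?Y" "A = ?c w"
      using A by (rule presented_monoid_carrierE)
    obtain v where v: "v \<in> lists ?Y" "(v @ w, []) \<in> word_cong ?Y ?R"
      using left_inverse[OF w(1)] by blast
    have "?c v \<otimes>\<^bsub>presented_monoid ?Y ?R\<^esub> A = \<one>\<^bsub>presented_monoid ?Y ?R\<^esub>"
      unfolding w(2) one presented_monoid_mult[OF v(1) w(1)]
      by (rule equiv_class_eq[OF equiv_word_cong v(2)])
    then show ?thesis using presented_monoid_carrierI[OF v(1)] by blast
  qed
  then show ?thesis
    unfolding presented_group_def by (intro groupI) (auto simp: m_assoc)
qed

section \<open>Garside monoids and Garside groups\<close>

text \<open>The divisibility relation \<open>factor\<close> of \<open>HOL-Algebra\<close> is left divisibility, but the gcd and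
  lcm notions built on it have no right-hand counterparts, so both sides are introduced here.\<close>

definition left_divides :: "('m, 'b) monoid_scheme \<Rightarrow> 'm \<Rightarrow> 'm \<Rightarrow> bool" where
  "left_divides M x z \<longleftrightarrow> (\<exists>t \<in> carrier M. z = x \<otimes>\<^bsub>M\<^esub> t)"

definition right_divides :: "('m, 'b) monoid_scheme \<Rightarrow> 'm \<Rightarrow> 'm \<Rightarrow> bool" where
  "right_divides M x z \<longleftrightarrow> (\<exists>t \<in> carrier M. z = t \<otimes>\<^bsub>M\<^esub> x)"

definition is_right_lcm :: "('m, 'b) monoid_scheme \<Rightarrow> 'm \<Rightarrow> 'm \<Rightarrow> 'm \<Rightarrow> bool" where
  "is_right_lcm M z x y \<longleftrightarrow> z \<in> carrier M \<and> left_divides M x z \<and> left_divides M y z \<and>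
    (\<forall>w \<in> carrier M. left_divides M x w \<and> left_divides M y w \<longrightarrow> left_divides M z w)"

definition is_left_lcm :: "('m, 'b) monoid_scheme \<Rightarrow> 'm \<Rightarrow> 'm \<Rightarrow> 'm \<Rightarrow> bool" where
  "is_left_lcm M z x y \<longleftrightarrow> z \<in> carrier M \<and> right_divides M x z \<and> right_divides M y z \<and>
    (\<forall>w \<in> carrier M. right_divides M x w \<and> right_divides M y w \<longrightarrow> right_divides M z w)"

definition is_left_gcd :: "('m, 'b) monoid_scheme \<Rightarrow> 'm \<Rightarrow> 'm \<Rightarrow> 'm \<Rightarrow> bool" where
  "is_left_gcd M z x y \<longleftrightarrow> z \<in> carrier M \<and> left_divides M z x \<and> left_divides M z y \<and>
    (\<forall>w \<in> carrier M. left_divides M w x \<and> left_divides M w y \<longrightarrow> left_divides M w z)"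

definition is_right_gcd :: "('m, 'b) monoid_scheme \<Rightarrow> 'm \<Rightarrow> 'm \<Rightarrow> 'm \<Rightarrow> bool" where
  "is_right_gcd M z x y \<longleftrightarrow> z \<in> carrier M \<and> right_divides M z x \<and> right_divides M z y \<and>
    (\<forall>w \<in> carrier M. right_divides M w x \<and> right_divides M w y \<longrightarrow> right_divides M w z)"

definition list_product :: "('m, 'b) monoid_scheme \<Rightarrow> 'm list \<Rightarrow> 'm" where
  "list_product M as = foldr (\<otimes>\<^bsub>M\<^esub>) as \<one>\<^bsub>M\<^esub>"

definition submonoid_generated :: "('m, 'b) monoid_scheme \<Rightarrow> 'm set \<Rightarrow> 'm set" where
  "submonoid_generated M A = list_product M ` lists A"

definition atoms :: "('m, 'b) monoid_scheme \<Rightarrow> 'm set" where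
  "atoms M = {x \<in> carrier M. x \<noteq> \<one>\<^bsub>M\<^esub> \<and>
    (\<forall>y \<in> carrier M. \<forall>z \<in> carrier M. x = y \<otimes>\<^bsub>M\<^esub> z \<longrightarrow> y = \<one>\<^bsub>M\<^esub> \<or> z = \<one>\<^bsub>M\<^esub>)}"

definition atomic_monoid :: "('m, 'b) monoid_scheme \<Rightarrow> bool" where
  "atomic_monoid M \<longleftrightarrow> monoid M \<and>
    submonoid_generated M (atoms M) = carrier M \<and>
    (\<forall>x \<in> carrier M. bdd_above {length as | as. as \<in> lists (atoms M) \<and> list_product M as = x})"

definition gaussian_monoid :: "('m, 'b) monoid_scheme \<Rightarrow> bool" where
  "gaussian_monoid M \<longleftrightarrow> atomic_monoid M \<and> monoid_cancel M \<and>
    (\<forall>x \<in> carrier M. \<forall>y \<in> carrier M.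
      (\<exists>z. is_left_gcd M z x y) \<and> (\<exists>z. is_right_gcd M z x y) \<and>
      (\<exists>z. is_left_lcm M z x y) \<and> (\<exists>z. is_right_lcm M z x y))"

definition garside_element :: "('m, 'b) monoid_scheme \<Rightarrow> 'm \<Rightarrow> bool" where
  "garside_element M \<Delta> \<longleftrightarrow> \<Delta> \<in> carrier M \<and>
    {x \<in> carrier M. left_divides M x \<Delta>} = {x \<in> carrier M. right_divides M x \<Delta>} \<and>
    finite {x \<in> carrier M. left_divides M x \<Delta>} \<and>
    submonoid_generated M {x \<in> carrier M. left_divides M x \<Delta>} = carrier M"

definition garside_monoid :: "('m, 'b) monoid_scheme \<Rightarrow> bool" where
  "garside_monoid M \<longleftrightarrow> gaussian_monoid M \<and> (\<exists>\<Delta>. garside_element M \<Delta>)"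

text \<open>\<open>G\<close> is the two-sided (Ore) group of fractions of \<open>M\<close> via the embedding \<open>\<iota>\<close>.
  When any two elements of \<open>M\<close> have common multiples on both sides, as in a Gaussian monoid,
  the conditions on left and on right fractions are equivalent.\<close>

definition group_of_fractions ::
    "('m, 'b) monoid_scheme \<Rightarrow> ('m \<Rightarrow> 'g) \<Rightarrow> ('g, 'c) monoid_scheme \<Rightarrow> bool" where
  "group_of_fractions M \<iota> G \<longleftrightarrow> monoid M \<and> group G \<and>
    \<iota> \<in> hom M G \<and> \<iota> \<one>\<^bsub>M\<^esub> = \<one>\<^bsub>G\<^esub> \<and> inj_on \<iota> (carrier M) \<and>
    (\<forall>g \<in> carrier G.
      (\<exists>a \<in> carrier M. \<exists>b \<in> carrier M. g = \<iota> a \<otimes>\<^bsub>G\<^esub> inv\<^bsub>G\<^esub> \<iota> b) \<and>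
      (\<exists>a \<in> carrier M. \<exists>b \<in> carrier M. g = inv\<^bsub>G\<^esub> \<iota> a \<otimes>\<^bsub>G\<^esub> \<iota> b))"

text \<open>A monoid embeds into its group of fractions, so it is no restriction to let its elements
  have the same type as those of \<open>G\<close>.\<close>

definition garside_group :: "('g, 'c) monoid_scheme \<Rightarrow> bool" where
  "garside_group G \<longleftrightarrow>
    (\<exists>(M :: 'g monoid) \<iota>. garside_monoid M \<and> group_of_fractions M \<iota> G)"

section \<open>Set-theoretical solutions of the quantum Yang-Baxter equation\<close>

text \<open>A map \<open>S\<close> on \<open>X \<times> X\<close> is written \<open>S (x, y) = (g\<^sub>x y, f\<^sub>y x)\<close>; the index is the first
  argument of \<open>g_map S\<close> and of \<open>f_map S\<close>.\<close>

definition g_map :: "('a \<times> 'a \<Rightarrow> 'a \<times> 'a) \<Rightarrow> 'a \<Rightarrow> 'a \<Rightarrow> 'a" where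
  "g_map S x y = fst (S (x, y))"

definition f_map :: "('a \<times> 'a \<Rightarrow> 'a \<times> 'a) \<Rightarrow> 'a \<Rightarrow> 'a \<Rightarrow> 'a" where
  "f_map S y x = snd (S (x, y))"

definition nondegenerate :: "'a set \<Rightarrow> ('a \<times> 'a \<Rightarrow> 'a \<times> 'a) \<Rightarrow> bool" where
  "nondegenerate X S \<longleftrightarrow> (\<forall>x \<in> X. bij_betw (f_map S x) X X \<and> bij_betw (g_map S x) X X)"

definition involutive :: "'a set \<Rightarrow> ('a \<times> 'a \<Rightarrow> 'a \<times> 'a) \<Rightarrow> bool" where
  "involutive X S \<longleftrightarrow> (\<forall>p \<in> X \<times> X. S (S p) = p)"

definition S12 :: "('a \<times> 'a \<Rightarrow> 'a \<times> 'a) \<Rightarrow> 'a \<times> 'a \<times> 'a \<Rightarrow> 'a \<times> 'a \<times> 'a" where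
  "S12 S = (\<lambda>(x, y, z). let (x', y') = S (x, y) in (x', y', z))"

definition S23 :: "('a \<times> 'a \<Rightarrow> 'a \<times> 'a) \<Rightarrow> 'a \<times> 'a \<times> 'a \<Rightarrow> 'a \<times> 'a \<times> 'a" where
  "S23 S = (\<lambda>(x, y, z). (x, S (y, z)))"

definition braided :: "'a set \<Rightarrow> ('a \<times> 'a \<Rightarrow> 'a \<times> 'a) \<Rightarrow> bool" where
  "braided X S \<longleftrightarrow> (\<forall>t \<in> X \<times> X \<times> X.
    (S12 S \<circ> S23 S \<circ> S12 S) t = (S23 S \<circ> S12 S \<circ> S23 S) t)"

definition ybe_solution :: "'a set \<Rightarrow> ('a \<times> 'a \<Rightarrow> 'a \<times> 'a) \<Rightarrow> bool" where
  "ybe_solution X S \<longleftrightarrow> X \<noteq> {} \<and> bij_betw S (X \<times> X) (X \<times> X) \<and> braided X S"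

definition structure_relations ::
    "'a set \<Rightarrow> ('a \<times> 'a \<Rightarrow> 'a \<times> 'a) \<Rightarrow> ('a list \<times> 'a list) set" where
  "structure_relations X S =
    {([x, y], [t, z]) | x y t z. x \<in> X \<and> y \<in> X \<and> S (x, y) = (t, z)}"

definition structure_group ::
    "'a set \<Rightarrow> ('a \<times> 'a \<Rightarrow> 'a \<times> 'a) \<Rightarrow> ('a \<times> bool) list set monoid" where
  "structure_group X S = presented_group X (structure_relations X S)"

section \<open>Occurrences of words in a set of relations\<close>

text \<open>An occurrence of a word in \<open>R\<close> is a relation of \<open>R\<close> together with one of its two sides; no
  word may have two of them. In particular a relation \<open>(u, u)\<close> is excluded, and so is having
  both \<open>(u, v)\<close> and \<open>(v, u)\<close> in \<open>R\<close>.\<close>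

definition sides_appear_once :: "('a list \<times> 'a list) set \<Rightarrow> bool" where
  "sides_appear_once R \<longleftrightarrow> inj_on (\<lambda>(r, b). if b then fst r else snd r) (R \<times> (UNIV :: bool set))"

end

theory Submission imports Defs begin

text \<open>Let \<open>star x y\<close> denote the inverse of the permutation \<open>g\<^sub>x\<close> applied to \<open>y\<close>. For a non-degenerate
  involutive \<open>S\<close> the relations of the structure group say that \<open>x (star x y) = y (star y x)\<close>, and \<open>S\<close> is
  braided if and only if \<open>star\<close> satisfies the cycle law
  \<open>star (star x y) (star x z) = star (star y x) (star y z)\<close>, see \<open>braided_iff_cycle_law\<close>. Both halves of
  the theorem are about this law.

  For a finite solution, the cycle law makes the assignment of the unit vector at \<open>x\<close> to the generator
  \<open>x\<close> extend to a cocycle, called charge, from the structure group \<open>G\<close> to the integer functions on \<open>X\<close>: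
  it satisfies \<open>charge (p q) = charge p + charge q \<circ> perm p\<close> for permutations \<open>perm p\<close> of \<open>X\<close>. The charge is
  bijective (\<open>structure_group_bijective_cocycle\<close>). It is onto because right multiplication by a suitable
  generator or inverse of a generator raises or lowers any one coordinate by one. It is injective because elements of \<open>G\<close> are left
  fractions of positive words and positive words of equal charge are congruent. Then the submonoid \<open>M\<close> of
  elements with nonnegative charge is a Garside monoid (\<open>bijective_cocycle.garside_group\<close>): left
  divisibility is the pointwise order of charges, right divisibility becomes this order after passing to
  inverses in \<open>G\<close>, so gcds and lcms come from pointwise minima and maxima, and the element of constant
  charge \<open>1\<close> is a Garside element.

  For the converse, let \<open>S\<close> exchange the two sides of each relation and fix the other words of length
  two. As relations preserve length, any two common multiples of length two of distinct letters are
  equal to the lcm of these letters, so that a pair of distinct letters starts (or ends) the two sides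
  of at most one relation. There are as many relations as such pairs, hence exactly one relation belongs
  to each pair, and this is non-degeneracy. For distinct \<open>x\<close>, \<open>y\<close>, \<open>z\<close> the cycle law compares the last
  letters of two words of length three that both represent the lcm of \<open>x (star x y)\<close> and \<open>z\<close>. If \<open>z\<close> equals
  \<open>x\<close> or \<open>y\<close>, it follows from the distinct case: two permutations that agree at all but two points agree up
  to an exchange of two values, and the exchange is excluded because \<open>x \<mapsto> star x x\<close> is injective.\<close>

section \<open>Involutive non-degenerate maps and their cycle sets\<close>

locale nondegenerate_involution =
  fixes X :: "'a set" and S :: "'a \<times> 'a \<Rightarrow> 'a \<times> 'a"
  assumes closed: "S ` (X \<times> X) \<subseteq> X \<times> X"
    and nondeg: "nondegenerate X S"
    and invol: "involutive X S"
begin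

abbreviation "g \<equiv> g_map S"
abbreviation "f \<equiv> f_map S"

text \<open>Both maps are extended by the identity outside \<open>X\<close>, which makes them mutually inverse
  permutations of the whole type.\<close>

definition act :: "'a \<Rightarrow> 'a \<Rightarrow> 'a" where
  "act x y = (if y \<in> X then g x y else y)"

definition star :: "'a \<Rightarrow> 'a \<Rightarrow> 'a" where
  "star x y = (if y \<in> X then inv_into X (g x) y else y)"

lemma S_eq: "S (x, y) = (g x y, f y x)"
  by (simp add: g_map_def f_map_def)

lemma g_bij: "x \<in> X \<Longrightarrow> bij_betw (g x) X X"
  and f_bij: "x \<in> X \<Longrightarrow> bij_betw (f x) X X"
  using nondeg by (auto simp: nondegenerate_def)

lemma g_closed [simp]: "x \<in> X \<Longrightarrow> y \<in> X \<Longrightarrow> g x y \<in> X"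
  and f_closed [simp]: "x \<in> X \<Longrightarrow> y \<in> X \<Longrightarrow> f x y \<in> X"
  using g_bij f_bij by (auto dest: bij_betwE)

lemma act_mem_iff [simp]: "x \<in> X \<Longrightarrow> act x y \<in> X \<longleftrightarrow> y \<in> X"
  by (simp add: act_def)

lemma star_mem_iff [simp]: "x \<in> X \<Longrightarrow> star x y \<in> X \<longleftrightarrow> y \<in> X"
  using g_bij[of x] by (auto simp: star_def bij_betw_def intro: inv_into_into)

lemma act_star [simp]: "x \<in> X \<Longrightarrow> act x (star x y) = y"
  using g_bij[of x] by (auto simp: act_def star_def bij_betw_def f_inv_into_f inv_into_into)

lemma star_act [simp]: "x \<in> X \<Longrightarrow> star x (act x y) = y"
  using g_bij[of x] by (auto simp: act_def star_def bij_betw_def)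

lemma star_eq_iff [simp]: "x \<in> X \<Longrightarrow> star x y = star x z \<longleftrightarrow> y = z"
  by (metis act_star)

lemma g_star [simp]: "x \<in> X \<Longrightarrow> y \<in> X \<Longrightarrow> g x (star x y) = y"
  using act_star[of x y] by (simp add: act_def)

lemma star_g [simp]: "x \<in> X \<Longrightarrow> y \<in> X \<Longrightarrow> star x (g x y) = y"
  using star_act[of x y] by (simp add: act_def)

lemma g_g_f: "x \<in> X \<Longrightarrow> y \<in> X \<Longrightarrow> g (g x y) (f y x) = x"
  using invol by (force simp: involutive_def S_eq)

lemma f_eq_star: "x \<in> X \<Longrightarrow> y \<in> X \<Longrightarrow> f y x = star (g x y) x"
  using g_g_f[of x y] star_g[of "g x y" "f y x"] by simp

lemma f_star [simp]: "x \<in> X \<Longrightarrow> y \<in> X \<Longrightarrow> f (star x y) x = star y x"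
  by (simp add: f_eq_star)

text \<open>Here surjectivity of \<open>f x\<close> enters: if \<open>S (a, x) = (b, y)\<close>, then \<open>x = star a b\<close> and
  \<open>y = star b a\<close>.\<close>

lemma ex_star_pair:
  assumes "x \<in> X" "y \<in> X"
  obtains a b where "a \<in> X" "b \<in> X" "star a b = x" "star b a = y"
proof -
  obtain a where a: "a \<in> X" "f x a = y"
    using f_bij[OF assms(1)] assms(2) by (metis bij_betw_apply bij_betw_inv_into_right
        bij_betw_inv_into)
  show ?thesis
    using a assms by (intro that[of a "g a x"]) (auto simp flip: f_eq_star)
qed

text \<open>The pairs fixed by \<open>S\<close> are \<open>(x, star x x)\<close>; since \<open>f z\<close> is injective for \<open>z = star x x\<close> and
  sends \<open>x\<close> to \<open>z\<close>, the second component determines the first.\<close>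

lemma star_diagonal_inj: "inj_on (\<lambda>x. star x x) X"
proof (rule inj_onI)
  fix x y assume "x \<in> X" "y \<in> X" "star x x = star y y"
  moreover from this have "f (star x x) x = f (star x x) y" using f_star[of x x] f_star[of y y] by simp
  moreover have "inj_on (f (star x x)) X" using f_bij[of "star x x"] \<open>x \<in> X\<close> by (simp add: bij_betw_def)
  ultimately show "x = y" by (meson inj_onD)
qed

lemma ex_star_diagonal:
  assumes "finite X" "y \<in> X"
  obtains x where "x \<in> X" "star x x = y"
proof -
  have "(\<lambda>x. star x x) ` X = X"
    using assms(1) star_diagonal_inj by (intro endo_inj_surj) auto
  then show ?thesis using assms(2) that by (metis (no_types, lifting) imageE)
qed

definition cycle_law :: bool where
  "cycle_law \<longleftrightarrow> (\<forall>x \<in> X. \<forall>y \<in> X. \<forall>z \<in> X.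
    star (star x y) (star x z) = star (star y x) (star y z))"

text \<open>In terms of \<open>g\<close>, the law says that the composite of \<open>g x\<close> and \<open>g y\<close> is the same for both sides
  of a structure relation, so that the structure group acts on \<open>X\<close> by the maps \<open>g x\<close>.\<close>

lemma cycle_law_iff:
  "cycle_law \<longleftrightarrow> (\<forall>x \<in> X. \<forall>y \<in> X. \<forall>z \<in> X. g x (g y z) = g (g x y) (g (f y x) z))"
    (is "_ \<longleftrightarrow> ?action")
proof
  assume RC: cycle_law
  show ?action
  proof (intro ballI)
    fix x y z assume xyz: "x \<in> X" "y \<in> X" "z \<in> X"
    define t where "t = g x y"
    define w where "w = g x (g y z)"
    have t: "t \<in> X" "y = star x t" "f y x = star t x" and w: "w \<in> X" "z = star y (star x w)"
      using xyz by (auto simp: t_def w_def f_eq_star)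
    have "z = star (star t x) (star t w)"
      using RC xyz t w unfolding cycle_law_def by metis
    then show "g x (g y z) = g (g x y) (g (f y x) z)"
    proof -
      have "g t (g (star t x) z) = w"
        using xyz t(1) w(1) \<open>z = star (star t x) (star t w)\<close> by simp
      then show ?thesis unfolding w_def[symmetric] t_def[symmetric] t(3) by simp
    qed
  qed
next
  assume action: ?action
  show cycle_law unfolding cycle_law_def
  proof (intro ballI)
    fix x y z assume xyz: "x \<in> X" "y \<in> X" "z \<in> X"
    define w where "w = star (star x y) (star x z)"
    have w: "w \<in> X" "g x (g (star x y) w) = z" using xyz by (auto simp: w_def)
    have "g x (g (star x y) w) = g y (g (star y x) w)"
      using action[rule_format, of x "star x y" w] xyz w(1) by simp
    then have "star (star y x) (star y z) = w" using w xyz by auto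
    then show "star (star x y) (star x z) = star (star y x) (star y z)" by (simp add: w_def)
  qed
qed

text \<open>In one direction the cycle law is the first component of the braid equation. Conversely, the
  law makes the coordinates \<open>(x, g x y, g x (g y z))\<close> of a triple \<open>(x, y, z)\<close> turn \<open>S12\<close> and \<open>S23\<close>
  into the two adjacent transpositions of three entries, which satisfy the braid relation.\<close>

lemma braided_iff_cycle_law: "braided X S \<longleftrightarrow> cycle_law"
proof
  assume "braided X S"
  then show cycle_law
    unfolding cycle_law_iff by (force simp: braided_def S12_def S23_def S_eq)
next
  assume "cycle_law"
  then have action: "g x (g y z) = g (g x y) (g (f y x) z)" if "x \<in> X" "y \<in> X" "z \<in> X" for x y z
    using that unfolding cycle_law_iff by blast
  let ?X3 = "X \<times> X \<times> X"
  define c where "c = (\<lambda>(x, y, z). (x, g x y, g x (g y z)))"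
  define s1 :: "'a \<times> 'a \<times> 'a \<Rightarrow> 'a \<times> 'a \<times> 'a" where "s1 = (\<lambda>(u, v, w). (v, u, w))"
  define s2 :: "'a \<times> 'a \<times> 'a \<Rightarrow> 'a \<times> 'a \<times> 'a" where "s2 = (\<lambda>(u, v, w). (u, w, v))"
  have c_inj: "inj_on c ?X3"
  proof (rule inj_onI)
    fix p q assume pq: "p \<in> ?X3" "q \<in> ?X3" "c p = c q"
    obtain x y z x' y' z' where eq: "p = (x, y, z)" "q = (x', y', z')" by (metis prod_cases3)
    have X: "x \<in> X" "y \<in> X" "z \<in> X" "y' \<in> X" "z' \<in> X" using pq(1,2) eq by auto
    have c: "x' = x" "g x y = g x y'" "g x (g y z) = g x (g y' z')"
      using pq(3) eq by (auto simp: c_def)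
    have g_inj: "v = v'" if "u \<in> X" "v \<in> X" "v' \<in> X" "g u v = g u v'" for u v v'
      using that g_bij by (meson bij_betw_def inj_onD)
    have "y' = y" using g_inj[of x y y'] c X by blast
    moreover have "g y z = g y z'"
      using g_inj[of x "g y z" "g y z'"] c X g_closed unfolding \<open>y' = y\<close> by blast
    then have "z' = z" using g_inj[of y z z'] X by blast
    ultimately show "p = q" by (simp only: eq c(1))
  qed
  have c1: "c (S12 S p) = s1 (c p)" if "p \<in> ?X3" for p
    using that g_g_f by (auto simp: c_def s1_def S12_def S_eq action[symmetric])
  have c2: "c (S23 S p) = s2 (c p)" if "p \<in> ?X3" for p
    using that g_g_f by (auto simp: c_def s2_def S23_def S_eq)
  have cl: "S12 S p \<in> ?X3" "S23 S p \<in> ?X3" if "p \<in> ?X3" for p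
    using that by (auto simp: S12_def S23_def S_eq)
  show "braided X S" unfolding braided_def
  proof
    fix p assume p: "p \<in> ?X3"
    have "s1 (s2 (s1 q)) = s2 (s1 (s2 q))" for q by (auto simp: s1_def s2_def split: prod.splits)
    then have "c (S12 S (S23 S (S12 S p))) = c (S23 S (S12 S (S23 S p)))"
      using p by (simp only: c1 c2 cl)
    then show "(S12 S \<circ> S23 S \<circ> S12 S) p = (S23 S \<circ> S12 S \<circ> S23 S) p"
      unfolding o_apply by (rule inj_onD[OF c_inj]) (use p in \<open>simp_all only: cl\<close>)
  qed
qed

end

section \<open>Garside structure from a bijective cocycle\<close>

text \<open>A bijection \<open>charge\<close> from a group onto the integer functions on a finite set that is additive up
  to permutations of the set. The elements of nonnegative charge form a submonoid, and the whole lattice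
  structure of divisibility is read off from the pointwise order of charges.\<close>

locale bijective_cocycle = group G for G (structure) +
  fixes X :: "'x set" and charge :: "'a \<Rightarrow> 'x \<Rightarrow> int" and perm :: "'a \<Rightarrow> 'x \<Rightarrow> 'x"
  assumes finite_X: "finite X"
    and perm_surj: "p \<in> carrier G \<Longrightarrow> surj (perm p)"
    and perm_X: "p \<in> carrier G \<Longrightarrow> bij_betw (perm p) X X"
    and charge_mult: "p \<in> carrier G \<Longrightarrow> q \<in> carrier G \<Longrightarrow>
      charge (p \<otimes> q) z = charge p z + charge q (perm p z)"
    and charge_bij: "bij_betw charge (carrier G) {a. \<forall>z. z \<notin> X \<longrightarrow> a z = 0}"
begin

definition positive_part :: "'a monoid" where
  "positive_part = \<lparr>carrier = {p \<in> carrier G. \<forall>z. 0 \<le> charge p z}, mult = (\<otimes>), one = \<one>\<rparr>"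

abbreviation "M \<equiv> positive_part"

lemma mult_M [simp]: "p \<otimes>\<^bsub>M\<^esub> q = p \<otimes> q" and one_M [simp]: "\<one>\<^bsub>M\<^esub> = \<one>"
  by (simp_all add: positive_part_def)

lemma carrier_M: "p \<in> carrier M \<longleftrightarrow> p \<in> carrier G \<and> (\<forall>z. 0 \<le> charge p z)"
  by (simp add: positive_part_def)

lemma M_G [simp]: "p \<in> carrier M \<Longrightarrow> p \<in> carrier G"
  by (simp add: carrier_M)

lemma charge_outside: "p \<in> carrier G \<Longrightarrow> z \<notin> X \<Longrightarrow> charge p z = 0"
  using charge_bij by (auto simp: bij_betw_def)

lemma charge_inj:
  assumes "p \<in> carrier G" "q \<in> carrier G" "\<And>z. charge p z = charge q z"
  shows "p = q"
proof (rule inj_onD[of charge "carrier G"])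
  show "inj_on charge (carrier G)" using charge_bij by (simp add: bij_betw_def)
  show "charge p = charge q" using assms(3) by (rule ext)
qed (use assms in auto)

lemma ex_charge:
  assumes "\<And>z. z \<notin> X \<Longrightarrow> a z = 0"
  obtains p where "p \<in> carrier G" "charge p = a"
proof -
  have "a \<in> charge ` carrier G" using charge_bij assms by (auto simp: bij_betw_def)
  then show ?thesis using that by blast
qed

lemma charge_one [simp]: "charge \<one> z = 0"
proof -
  obtain y where "z = perm \<one> y" using perm_surj[of \<one>] by auto
  then show ?thesis using charge_mult[of \<one> \<one> y] by simp
qed

text \<open>In \<open>q = p \<otimes> (inv p \<otimes> q)\<close> the charge of the second factor enters only up to a permutation of
  its arguments, which does not affect its sign.\<close>

lemma charge_le_iff:
  assumes "p \<in> carrier G" "q \<in> carrier G"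
  shows "(\<forall>z. charge p z \<le> charge q z) \<longleftrightarrow> inv p \<otimes> q \<in> carrier M"
proof -
  have "charge q z = charge p z + charge (inv p \<otimes> q) (perm p z)" for z
    using charge_mult[of p "inv p \<otimes> q" z] assms by (simp add: m_assoc[symmetric])
  then have "(\<forall>z. charge p z \<le> charge q z) \<longleftrightarrow> (\<forall>z. 0 \<le> charge (inv p \<otimes> q) (perm p z))"
    by simp
  also have "\<dots> \<longleftrightarrow> (\<forall>z. 0 \<le> charge (inv p \<otimes> q) z)"
    using perm_surj[OF assms(1)] by (metis surjD)
  finally show ?thesis using assms by (simp add: carrier_M)
qed

lemma inv_mem_M_iff:
  "p \<in> carrier G \<Longrightarrow> inv p \<in> carrier M \<longleftrightarrow> (\<forall>z. charge p z \<le> 0)"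
  using charge_le_iff[of p \<one>] by simp

lemma charge_inv_le:
  "p \<in> carrier M \<Longrightarrow> charge (inv p) z \<le> 0"
  using inv_mem_M_iff[of "inv p"] by simp

lemma left_divides_iff:
  assumes "p \<in> carrier G" "q \<in> carrier G"
  shows "left_divides M p q \<longleftrightarrow> (\<forall>z. charge p z \<le> charge q z)"
proof -
  have "left_divides M p q \<longleftrightarrow> inv p \<otimes> q \<in> carrier M"
  proof
    assume "left_divides M p q"
    then show "inv p \<otimes> q \<in> carrier M"
      using assms by (auto simp: left_divides_def m_assoc[symmetric])
  next
    assume "inv p \<otimes> q \<in> carrier M"
    moreover have "q = p \<otimes> (inv p \<otimes> q)" using assms by (simp add: m_assoc[symmetric])
    ultimately show "left_divides M p q" by (auto simp: left_divides_def)
  qed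
  then show ?thesis by (simp add: charge_le_iff assms)
qed

lemma right_divides_iff:
  assumes "p \<in> carrier G" "q \<in> carrier G"
  shows "right_divides M p q \<longleftrightarrow> (\<forall>z. charge (inv q) z \<le> charge (inv p) z)"
proof -
  have "right_divides M p q \<longleftrightarrow> q \<otimes> inv p \<in> carrier M"
  proof
    assume "right_divides M p q"
    then show "q \<otimes> inv p \<in> carrier M"
      using assms by (auto simp: right_divides_def m_assoc)
  next
    assume "q \<otimes> inv p \<in> carrier M"
    moreover have "q = (q \<otimes> inv p) \<otimes> p" using assms by (simp add: m_assoc)
    ultimately show "right_divides M p q" by (auto simp: right_divides_def)
  qed
  then show ?thesis using charge_le_iff[of "inv q" "inv p"] assms by simp
qed

lemma monoid_M: "monoid M"
  by (rule monoidI) (auto simp: carrier_M charge_mult m_assoc)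

lemma monoid_cancel_M: "monoid_cancel M"
  by (rule monoid.monoid_cancelI[OF monoid_M]) auto

lemma ex_left_gcd:
  assumes "p \<in> carrier M" "q \<in> carrier M"
  shows "\<exists>d. is_left_gcd M d p q"
proof -
  obtain d where "d \<in> carrier G" "charge d = (\<lambda>z. min (charge p z) (charge q z))"
    using ex_charge[of "\<lambda>z. min (charge p z) (charge q z)"] assms by (auto simp: charge_outside)
  then show ?thesis
    using assms by (intro exI[of _ d]) (simp add: is_left_gcd_def left_divides_iff carrier_M)
qed

lemma ex_right_lcm:
  assumes "p \<in> carrier M" "q \<in> carrier M"
  shows "\<exists>d. is_right_lcm M d p q"
proof -
  obtain d where "d \<in> carrier G" "charge d = (\<lambda>z. max (charge p z) (charge q z))"
    using ex_charge[of "\<lambda>z. max (charge p z) (charge q z)"] assms by (auto simp: charge_outside)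
  then show ?thesis
    using assms by (intro exI[of _ d]) (simp add: is_right_lcm_def left_divides_iff carrier_M le_max_iff_disj)
qed

text \<open>Right divisibility of \<open>p\<close> and \<open>q\<close> is the reversed pointwise order on the charges of their
  inverses. The inverses need not lie in the monoid, but \<open>charge\<close> covers all integer functions, so
  minima and maxima exist there as well.\<close>

lemma ex_right_gcd:
  assumes "p \<in> carrier M" "q \<in> carrier M"
  shows "\<exists>d. is_right_gcd M d p q"
proof -
  obtain d where d: "d \<in> carrier G" "charge d = (\<lambda>z. max (charge (inv p) z) (charge (inv q) z))"
    using ex_charge[of "\<lambda>z. max (charge (inv p) z) (charge (inv q) z)"] assms
    by (auto simp: charge_outside)
  then have "inv d \<in> carrier M"
    using assms by (simp add: inv_mem_M_iff charge_inv_le)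
  then show ?thesis
    using assms d by (intro exI[of _ "inv d"]) (simp add: is_right_gcd_def right_divides_iff)
qed

lemma ex_left_lcm:
  assumes "p \<in> carrier M" "q \<in> carrier M"
  shows "\<exists>d. is_left_lcm M d p q"
proof -
  obtain d where d: "d \<in> carrier G" "charge d = (\<lambda>z. min (charge (inv p) z) (charge (inv q) z))"
    using ex_charge[of "\<lambda>z. min (charge (inv p) z) (charge (inv q) z)"] assms
    by (auto simp: charge_outside)
  then have "inv d \<in> carrier M"
    using assms by (simp add: inv_mem_M_iff charge_inv_le min_le_iff_disj)
  then show ?thesis
    using assms d by (intro exI[of _ "inv d"]) (simp add: is_left_lcm_def right_divides_iff)
qed

definition degree :: "'a \<Rightarrow> nat" where
  "degree p = nat (\<Sum>z\<in>X. charge p z)"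

lemma degree_mult:
  assumes "p \<in> carrier M" "q \<in> carrier M"
  shows "degree (p \<otimes> q) = degree p + degree q"
proof -
  have "(\<Sum>z\<in>X. charge q (perm p z)) = (\<Sum>z\<in>X. charge q z)"
    using assms perm_X[of p] by (intro sum.reindex_bij_betw) simp
  then show ?thesis
    using assms by (simp add: degree_def charge_mult sum.distrib nat_add_distrib sum_nonneg carrier_M)
qed

lemma degree_eq_0_iff:
  assumes "p \<in> carrier M"
  shows "degree p = 0 \<longleftrightarrow> p = \<one>"
proof
  assume "degree p = 0"
  then have "(\<Sum>z\<in>X. charge p z) = 0"
    using assms by (simp add: degree_def antisym sum_nonneg carrier_M)
  then have "charge p z = 0" for z
    using assms charge_outside[of p z]
    by (cases "z \<in> X") (auto simp: finite_X sum_nonneg_eq_0_iff carrier_M)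
  then show "p = \<one>" using assms by (intro charge_inj) auto
qed (simp add: degree_def)

lemma list_product_Cons: "list_product M (p # ps) = p \<otimes> list_product M ps"
  and list_product_Nil: "list_product M [] = \<one>"
  by (simp_all add: list_product_def)

lemma list_product_closed: "ps \<in> lists (carrier M) \<Longrightarrow> list_product M ps \<in> carrier M"
  using monoid.m_closed[OF monoid_M] monoid.one_closed[OF monoid_M]
  by (induction ps) (auto simp: list_product_Cons list_product_Nil)

lemma list_product_append:
  "ps \<in> lists (carrier M) \<Longrightarrow> qs \<in> lists (carrier M) \<Longrightarrow>
    list_product M (ps @ qs) = list_product M ps \<otimes> list_product M qs"
proof (induction ps)
  case (Cons p ps)
  then show ?case
    using list_product_closed[of ps] list_product_closed[of qs]
    by (simp add: list_product_Cons m_assoc)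
qed (use list_product_closed[of qs] in \<open>simp add: list_product_Nil\<close>)

lemma atoms_sub: "lists (atoms M) \<subseteq> lists (carrier M)"
  by (rule lists_mono) (auto simp: atoms_def)

lemma ex_atom_factorization:
  "p \<in> carrier M \<Longrightarrow> \<exists>ps \<in> lists (atoms M). list_product M ps = p"
proof (induction "degree p" arbitrary: p rule: less_induct)
  case less
  show ?case
  proof (cases "p = \<one> \<or> p \<in> atoms M")
    case True
    then show ?thesis
    proof
      assume "p = \<one>"
      then show ?thesis by (intro bexI[of _ "[]"]) (auto simp: list_product_Nil)
    next
      assume "p \<in> atoms M"
      then show ?thesis using less.prems by (intro bexI[of _ "[p]"]) (auto simp: list_product_Nil list_product_Cons)
    qed
  next
    case False
    then obtain q r where qr: "q \<in> carrier M" "r \<in> carrier M" "p = q \<otimes> r" "q \<noteq> \<one>" "r \<noteq> \<one>"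
      using less.prems by (auto simp: atoms_def)
    then have "degree q < degree p" "degree r < degree p"
      by (simp_all add: degree_mult degree_eq_0_iff zero_less_iff_neq_zero)
    then obtain qs rs where "qs \<in> lists (atoms M)" "list_product M qs = q"
      "rs \<in> lists (atoms M)" "list_product M rs = r"
      using less.hyps qr by metis
    then show ?thesis
      using qr atoms_sub by (intro bexI[of _ "qs @ rs"]) (auto simp: list_product_append subset_iff)
  qed
qed

lemma length_le_degree:
  "ps \<in> lists (atoms M) \<Longrightarrow> length ps \<le> degree (list_product M ps)"
proof (induction ps)
  case (Cons p ps)
  then have "p \<in> carrier M" "degree p \<noteq> 0" "list_product M ps \<in> carrier M"
    using list_product_closed[of ps] atoms_sub by (auto simp: atoms_def degree_eq_0_iff)
  then show ?case using Cons by (simp add: list_product_Cons degree_mult)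
qed simp

lemma atomic_M: "atomic_monoid M"
  unfolding atomic_monoid_def
proof (intro conjI ballI monoid_M)
  show "submonoid_generated M (atoms M) = carrier M"
    using ex_atom_factorization list_product_closed atoms_sub
    by (fastforce simp: submonoid_generated_def)
next
  fix p assume "p \<in> carrier M"
  show "bdd_above {length ps | ps. ps \<in> lists (atoms M) \<and> list_product M ps = p}"
    using length_le_degree by (intro bdd_aboveI[of _ "degree p"]) blast
qed

lemma gaussian_M: "gaussian_monoid M"
  unfolding gaussian_monoid_def
  using atomic_M monoid_cancel_M ex_left_gcd ex_right_gcd ex_left_lcm ex_right_lcm by blast

text \<open>An element of the monoid with nonzero charge at \<open>x\<close> is left divisible by the element whose
  charge is the unit function at \<open>x\<close>; an atom therefore coincides with it.\<close>

lemma atom_charge_le_1: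
  assumes "p \<in> atoms M"
  shows "charge p z \<le> 1"
proof -
  have p: "p \<in> carrier M" "p \<noteq> \<one>" using assms by (auto simp: atoms_def)
  then obtain x where x: "charge p x \<noteq> 0"
    using charge_inj[of p \<one>] by auto
  then have "x \<in> X" using p charge_outside by (metis M_G)
  then obtain q where q: "q \<in> carrier G" "charge q = (\<lambda>z. of_bool (z = x))"
    using ex_charge[of "\<lambda>z. of_bool (z = x)"] by auto
  have nonneg: "0 \<le> charge p z" for z using p(1) by (simp add: carrier_M)
  have "of_bool (z = x) \<le> charge p z" for z
    using nonneg[of z] x by (cases "z = x") auto
  then have "left_divides M q p"
    using q p(1) by (simp add: left_divides_iff)
  then obtain r where "r \<in> carrier M" "p = q \<otimes> r" by (auto simp: left_divides_def)
  moreover have "q \<in> carrier M" using q by (simp add: carrier_M)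
  ultimately have "q = \<one> \<or> r = \<one>" using assms by (auto simp: atoms_def)
  moreover have "q \<noteq> \<one>"
  proof
    assume "q = \<one>"
    then have "charge q x = 0" by simp
    then show False using q(2) by simp
  qed
  ultimately have "p = q" using \<open>p = q \<otimes> r\<close> q by auto
  then show ?thesis using q by simp
qed

text \<open>The element \<open>\<Delta>\<close> of constant charge \<open>1\<close> on \<open>X\<close> has the elements of charge at most \<open>1\<close> as its left
  divisors. Its right divisors are the complements \<open>inv p \<otimes> \<Delta>\<close> of its left divisors, and taking
  complements is an injective map of the finite set of left divisors into itself.\<close>

lemma ex_garside_element: "\<exists>\<Delta>. garside_element M \<Delta>"
proof -
  obtain \<Delta> where \<Delta>: "\<Delta> \<in> carrier G" "charge \<Delta> = (\<lambda>z. of_bool (z \<in> X))"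
    using ex_charge[of "\<lambda>z. of_bool (z \<in> X)"] by auto
  then have \<Delta>M: "\<Delta> \<in> carrier M" by (simp add: carrier_M)
  define D where "D = {p \<in> carrier M. \<forall>z. charge p z \<le> 1}"
  have left: "{p \<in> carrier M. left_divides M p \<Delta>} = D"
  proof -
    have "(\<forall>z. charge p z \<le> of_bool (z \<in> X)) \<longleftrightarrow> (\<forall>z. charge p z \<le> 1)" if "p \<in> carrier M" for p
    proof -
      have "charge p z \<le> of_bool (z \<in> X) \<longleftrightarrow> charge p z \<le> 1" for z
        using that charge_outside[of p z] by (cases "z \<in> X") auto
      then show ?thesis by simp
    qed
    then show ?thesis using \<Delta> by (auto simp: D_def left_divides_iff)
  qed
  have "finite D"
  proof -
    have "charge ` D \<subseteq> (\<lambda>A z. of_bool (z \<in> A)) ` Pow X"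
    proof (rule image_subsetI)
      fix p assume "p \<in> D"
      then have p: "p \<in> carrier M" "0 \<le> charge p z" "charge p z \<le> 1" for z
        by (auto simp: D_def carrier_M)
      have "charge p z = of_bool (z \<in> {z \<in> X. charge p z = 1})" for z
        using p(2)[of z] p(3)[of z] charge_outside[of p z] p(1)
        by (cases "z \<in> X"; cases "charge p z = 1") auto
      then show "charge p \<in> (\<lambda>A z. of_bool (z \<in> A)) ` Pow X"
        by (intro image_eqI[of _ _ "{z \<in> X. charge p z = 1}"]) auto
    qed
    then have "finite (charge ` D)" using finite_X by (meson finite_Pow_iff finite_imageI finite_subset)
    moreover have "inj_on charge D"
      using charge_bij by (auto simp: bij_betw_def D_def inj_on_def)
    ultimately show ?thesis by (rule finite_imageD)
  qed
  define co where "co p = inv p \<otimes> \<Delta>" for p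
  have co_D: "co p \<in> D" if "p \<in> D" for p
  proof -
    have p: "p \<in> carrier M" "p \<in> carrier G" using that by (auto simp: D_def)
    have "charge (co p) z \<le> 1" for z
    proof -
      obtain y where y: "z = perm p y" using perm_surj[OF p(2)] by auto
      have "charge \<Delta> y = charge p y + charge (co p) z"
        using charge_mult[of p "co p" y] p \<Delta> unfolding co_def y by (simp add: m_assoc[symmetric])
      moreover have "charge \<Delta> y \<le> 1" "0 \<le> charge p y" using \<Delta> p by (auto simp: carrier_M)
      ultimately show ?thesis by linarith
    qed
    moreover have "co p \<in> carrier M"
      using that p \<Delta> left left_divides_iff[of p \<Delta>] charge_le_iff[of p \<Delta>] unfolding co_def by blast
    ultimately show ?thesis by (simp add: D_def)
  qed
  have "inj_on co D"
    using \<Delta> by (auto simp: inj_on_def co_def D_def dest!: inj_onD[OF inv_inj])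
  then have co_surj: "co ` D = D" using co_D \<open>finite D\<close> by (intro endo_inj_surj) auto
  have right: "{p \<in> carrier M. right_divides M p \<Delta>} = D"
  proof (intro subset_antisym subsetI)
    fix p assume "p \<in> {p \<in> carrier M. right_divides M p \<Delta>}"
    then obtain t where t: "p \<in> carrier M" "t \<in> carrier M" "\<Delta> = t \<otimes> p" by (auto simp: right_divides_def)
    then have "t \<in> D" using left by (auto simp: left_divides_def)
    moreover have "p = co t" using t by (simp add: co_def m_assoc[symmetric])
    ultimately show "p \<in> D" using co_D by simp
  next
    fix p assume "p \<in> D"
    then obtain t where t: "t \<in> D" "p = co t" using co_surj by auto
    then have "\<Delta> = t \<otimes> p" using \<Delta> by (simp add: co_def D_def m_assoc[symmetric])
    then show "p \<in> {p \<in> carrier M. right_divides M p \<Delta>}"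
      using t \<open>p \<in> D\<close> by (auto simp: right_divides_def D_def)
  qed
  have "submonoid_generated M D = carrier M"
  proof
    show "submonoid_generated M D \<subseteq> carrier M"
      using list_product_closed lists_mono[of D "carrier M"] by (auto simp: submonoid_generated_def D_def)
    have "lists (atoms M) \<subseteq> lists D"
      using atom_charge_le_1 by (intro lists_mono) (auto simp: D_def atoms_def)
    then show "carrier M \<subseteq> submonoid_generated M D"
      using ex_atom_factorization by (fastforce simp: submonoid_generated_def)
  qed
  then have "garside_element M \<Delta>"
    unfolding garside_element_def left right using \<Delta>M \<open>finite D\<close> by simp
  then show ?thesis ..
qed

text \<open>A group element \<open>p\<close> is written as a fraction by comparing it with \<open>\<one>\<close>: the supremum of \<open>p\<close>
  and \<open>\<one>\<close> for the pointwise order of charges is the numerator of a right fraction, and the inverse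
  of their infimum is a common denominator on the left.\<close>

lemma group_of_fractions_M: "group_of_fractions M (\<lambda>p. p) G"
  unfolding group_of_fractions_def
proof (intro conjI ballI monoid_M is_group)
  show "(\<lambda>p. p) \<in> hom M G" by (auto simp: hom_def)
  fix p assume p: "p \<in> carrier G"
  obtain a where a: "a \<in> carrier G" "charge a = (\<lambda>z. max (charge p z) 0)"
    using ex_charge[of "\<lambda>z. max (charge p z) 0"] p by (auto simp: charge_outside)
  have "a \<in> carrier M" "inv p \<otimes> a \<in> carrier M"
    using p a charge_le_iff[of p a] by (simp_all add: carrier_M)
  moreover have "p = a \<otimes> inv (inv p \<otimes> a)"
    using p a by (simp add: inv_mult_group m_assoc[symmetric])
  ultimately show "\<exists>a\<in>carrier M. \<exists>b\<in>carrier M. p = a \<otimes> inv b" by blast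
  obtain d where d: "d \<in> carrier G" "charge d = (\<lambda>z. min (charge p z) 0)"
    using ex_charge[of "\<lambda>z. min (charge p z) 0"] p by (auto simp: charge_outside)
  have "inv d \<in> carrier M" "inv d \<otimes> p \<in> carrier M"
    using p d charge_le_iff[of d p] by (simp_all add: inv_mem_M_iff)
  moreover have "p = inv (inv d) \<otimes> (inv d \<otimes> p)"
    using p d by (simp add: m_assoc[symmetric])
  ultimately show "\<exists>a\<in>carrier M. \<exists>b\<in>carrier M. p = inv a \<otimes> b" by blast
qed auto

theorem garside_group: "garside_group G"
  unfolding garside_group_def garside_monoid_def
  using gaussian_M ex_garside_element group_of_fractions_M by blast

end

section \<open>The bijective cocycle of a structure group\<close>

locale finite_cycle_set = nondegenerate_involution +
  assumes finite_X: "finite X" and cycle: cycle_law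
begin

abbreviation "letters \<equiv> X \<times> (UNIV :: bool set)"
abbreviation "rels \<equiv> group_relations X (structure_relations X S)"

text \<open>Being a word over \<open>X\<close> is kept as a single fact in what follows, rather than unfolded into a
  statement about the letters, so that the closure lemmas for words apply.\<close>

declare in_lists_conv_set [simp del] in_listsD [rule del] in_listsI [rule del]

definition cong :: "('a \<times> bool) list \<Rightarrow> ('a \<times> bool) list \<Rightarrow> bool" (infix "\<approx>" 50) where
  "u \<approx> v \<longleftrightarrow> (u, v) \<in> word_cong letters rels"

lemma rev_in_lists [simp]: "rev u \<in> lists A \<longleftrightarrow> u \<in> lists A"
  by (simp add: in_lists_conv_set)

lemma star_star:
  "x \<in> X \<Longrightarrow> y \<in> X \<Longrightarrow> star (star x y) (star x z) = star (star y x) (star y z)"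
  by (cases "z \<in> X") (use cycle in \<open>auto simp: cycle_law_def star_def\<close>)

text \<open>The group word \<open>w\<close> acts on integer functions on \<open>X\<close> by
  \<open>a \<mapsto> word_charge w + a \<circ> word_perm w\<close>, and a generator \<open>x\<close> by translation with the unit function
  at \<open>x\<close> after a permutation. Composition of these affine maps gives the recursion for
  \<open>word_charge\<close>; the clause for an inverse letter is the one that makes \<open>x\<close> and its inverse act as
  inverse maps. The permutations compose in the order in which a word is read.\<close>

fun letter_perm :: "'a \<times> bool \<Rightarrow> 'a \<Rightarrow> 'a" where
  "letter_perm (x, b) z = (if b then star x z else act x z)"

fun letter_charge :: "'a \<times> bool \<Rightarrow> 'a \<Rightarrow> int" where
  "letter_charge (x, b) z = (if b then of_bool (z = x) else - of_bool (act x z = x))"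

fun word_perm :: "('a \<times> bool) list \<Rightarrow> 'a \<Rightarrow> 'a" where
  "word_perm [] z = z"
| "word_perm (l # w) z = word_perm w (letter_perm l z)"

fun word_charge :: "('a \<times> bool) list \<Rightarrow> 'a \<Rightarrow> int" where
  "word_charge [] z = 0"
| "word_charge (l # w) z = letter_charge l z + word_charge w (letter_perm l z)"

lemma word_perm_append: "word_perm (u @ v) z = word_perm v (word_perm u z)"
  by (induction u arbitrary: z) auto

lemma word_charge_append:
  "word_charge (u @ v) z = word_charge u z + word_charge v (word_perm u z)"
  by (induction u arbitrary: z) auto

lemma letter_perm_mem_iff: "l \<in> letters \<Longrightarrow> letter_perm l z \<in> X \<longleftrightarrow> z \<in> X"
  by (cases l) auto

lemma word_perm_mem_iff: "w \<in> lists letters \<Longrightarrow> word_perm w z \<in> X \<longleftrightarrow> z \<in> X"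
  by (induction w arbitrary: z) (auto simp: letter_perm_mem_iff simp del: letter_perm.simps)

lemma bij_letter_perm: "l \<in> letters \<Longrightarrow> bij (letter_perm l)"
  by (cases l, cases "snd l")
    (auto intro!: bij_betw_byWitness[where f' = "letter_perm (fst l, \<not> snd l)"])

lemma bij_word_perm: "w \<in> lists letters \<Longrightarrow> bij (word_perm w)"
proof (induction w)
  case Nil
  have "word_perm [] = id" by (auto simp: fun_eq_iff)
  then show ?case by (simp only: bij_id)
next
  case (Cons l w)
  have "word_perm (l # w) = word_perm w \<circ> letter_perm l" by (auto simp: fun_eq_iff)
  then show ?case using Cons.IH Cons.prems bij_letter_perm[of l] by (simp only: bij_comp Cons_in_lists_iff)
qed

lemma bij_word_perm_X: "w \<in> lists letters \<Longrightarrow> bij_betw (word_perm w) X X"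
  using bij_word_perm[of w] word_perm_mem_iff[of w]
  by (auto simp: bij_betw_def inj_on_def bij_def surj_def) (metis imageI)

lemma word_charge_outside: "w \<in> lists letters \<Longrightarrow> z \<notin> X \<Longrightarrow> word_charge w z = 0"
proof (induction w arbitrary: z)
  case (Cons l w)
  then have "letter_perm l z \<notin> X" using letter_perm_mem_iff by auto
  moreover have "letter_charge l z = 0"
    using Cons.prems by (cases l) (auto simp: act_def)
  ultimately show ?case using Cons by auto
qed simp

text \<open>For the relation \<open>x (star x y) = y (star y x)\<close> the charge of both sides is the sum of
  the unit functions at \<open>x\<close> and \<open>y\<close>, and equality of the two permutations is the cycle law.\<close>

lemma relation_invariance:
  assumes "(u, v) \<in> rels"
  shows "word_perm u = word_perm v \<and> word_charge u = word_charge v"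
  using assms unfolding group_relations_def
proof
  assume "(u, v) \<in> (\<lambda>(u, v). (map (\<lambda>x. (x, True)) u, map (\<lambda>x. (x, True)) v)) ` structure_relations X S"
  then obtain x y t z where *: "x \<in> X" "y \<in> X" "S (x, y) = (t, z)"
    "u = [(x, True), (y, True)]" "v = [(t, True), (z, True)]"
    by (auto simp: structure_relations_def)
  then have t: "t \<in> X" "z = star t x" "y = star x t"
    by (auto simp: S_eq f_eq_star)
  then show ?thesis
    using * star_star[of x t] by (auto simp: fun_eq_iff)
next
  assume "(u, v) \<in> {([(x, b), (x, \<not> b)], []) |x b. x \<in> X}"
  then show ?thesis by (auto simp: fun_eq_iff)
qed

lemma cong_invariance:
  "u \<approx> v \<Longrightarrow> word_perm u = word_perm v \<and> word_charge u = word_charge v"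
  unfolding cong_def
proof (induction rule: word_cong.induct)
  case (rel u v p q)
  then show ?case using relation_invariance[of u v]
    by (auto simp: fun_eq_iff word_perm_append word_charge_append)
qed auto

definition pos :: "'a list \<Rightarrow> ('a \<times> bool) list" where
  "pos u = map (\<lambda>x. (x, True)) u"

definition neg :: "'a list \<Rightarrow> ('a \<times> bool) list" where
  "neg u = map (\<lambda>x. (x, False)) u"

lemma pos_simps [simp]: "pos [] = []" "pos (x # u) = (x, True) # pos u" "pos (u @ v) = pos u @ pos v"
  and neg_simps [simp]: "neg [] = []" "neg (x # u) = (x, False) # neg u" "neg (u @ v) = neg u @ neg v"
  by (simp_all add: pos_def neg_def)

lemma pos_letters [simp]: "u \<in> lists X \<Longrightarrow> pos u \<in> lists letters"
  and neg_letters [simp]: "u \<in> lists X \<Longrightarrow> neg u \<in> lists letters"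
  by (auto simp: pos_def neg_def in_lists_conv_set)

lemma word_charge_pos_nonneg: "0 \<le> word_charge (pos u) z"
  by (induction u arbitrary: z) auto

lemma nonneg_charge_induct [consumes 1, case_names zero unit]:
  fixes a :: "'a \<Rightarrow> int"
  assumes "\<forall>z. 0 \<le> a z \<and> (z \<notin> X \<longrightarrow> a z = 0)"
    and zero: "P (\<lambda>z. 0)"
    and unit: "\<And>b y. P b \<Longrightarrow> y \<in> X \<Longrightarrow> P (\<lambda>z. b z + of_bool (z = y))"
  shows "P a"
  using assms(1)
proof (induction "nat (\<Sum>z\<in>X. a z)" arbitrary: a rule: less_induct)
  case less
  show ?case
  proof (cases "a = (\<lambda>z. 0)")
    case False
    then obtain y where "a y \<noteq> 0" by auto
    then have y: "y \<in> X" "1 \<le> a y" using less.prems[rule_format, of y] by force+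
    define b where "b z = a z - of_bool (z = y)" for z
    have b: "0 \<le> b z" "z \<notin> X \<Longrightarrow> b z = 0" for z
      using less.prems y by (auto simp: b_def)
    have "(\<Sum>z\<in>X. b z) < (\<Sum>z\<in>X. a z)"
      using y finite_X by (intro sum_strict_mono_ex1) (auto simp: b_def)
    moreover have "0 \<le> (\<Sum>z\<in>X. b z)" by (simp add: b sum_nonneg)
    ultimately have "P b" using less.hyps[of b] b by auto
    then have "P (\<lambda>z. b z + of_bool (z = y))" using unit y(1) by blast
    then show ?thesis by (simp add: b_def)
  qed (simp add: zero)
qed

lemma ex_pos_word_charge:
  assumes "\<And>z. 0 \<le> a z" "\<And>z. z \<notin> X \<Longrightarrow> a z = 0"
  shows "\<exists>u \<in> lists X. word_charge (pos u) = a"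
proof -
  have "\<forall>z. 0 \<le> a z \<and> (z \<notin> X \<longrightarrow> a z = 0)" using assms by blast
  then show ?thesis
  proof (induction a rule: nonneg_charge_induct)
    case zero
    show ?case by (intro bexI[of _ "[]"]) auto
  next
    case (unit b y)
    then obtain u where u: "u \<in> lists X" "word_charge (pos u) = b" by blast
    define x where "x = word_perm (pos u) y"
    have "x \<in> X" using u unit by (simp add: x_def word_perm_mem_iff)
    moreover have "word_perm (pos u) z = x \<longleftrightarrow> z = y" for z
      using bij_word_perm[of "pos u"] u by (auto simp: x_def bij_def inj_eq)
    then have "word_charge (pos (u @ [x])) = (\<lambda>z. b z + of_bool (z = y))"
      using u by (auto simp: fun_eq_iff word_charge_append)
    ultimately show ?case using u by (intro bexI[of _ "u @ [x]"]) auto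
  qed
qed

text \<open>Appending the inverse of \<open>x\<close> to \<open>w\<close> subtracts a unit at the place where \<open>word_perm w\<close> takes
  the value \<open>star x x\<close>, so any unit can be subtracted because every letter is of this form.\<close>

lemma ex_nonpos_word_charge:
  assumes "\<And>z. 0 \<le> a z" "\<And>z. z \<notin> X \<Longrightarrow> a z = 0"
  shows "\<exists>w \<in> lists letters. \<forall>z. word_charge w z = - a z"
proof -
  have "\<forall>z. 0 \<le> a z \<and> (z \<notin> X \<longrightarrow> a z = 0)" using assms by blast
  then show ?thesis
  proof (induction a rule: nonneg_charge_induct)
    case zero
    show ?case by (intro bexI[of _ "[]"]) auto
  next
    case (unit b y)
    then obtain w where w: "w \<in> lists letters" "\<And>z. word_charge w z = - b z" by blast
    have "word_perm w y \<in> X" using w unit by (simp add: word_perm_mem_iff)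
    then obtain x where x: "x \<in> X" "star x x = word_perm w y"
      using ex_star_diagonal[OF finite_X] by metis
    have "act x (word_perm w z) = x \<longleftrightarrow> z = y" for z
    proof -
      have "act x (word_perm w z) = x \<longleftrightarrow> word_perm w z = star x x"
        using x(1) by (metis act_star star_act)
      then show ?thesis using bij_word_perm[OF w(1)] x(2) by (simp add: bij_def inj_eq)
    qed
    then have "word_charge (w @ [(x, False)]) z = - (b z + of_bool (z = y))" for z
      using w by (simp add: word_charge_append)
    then show ?case using w x by (intro bexI[of _ "w @ [(x, False)]"]) auto
  qed
qed

lemma ex_word_charge:
  assumes "\<And>z. z \<notin> X \<Longrightarrow> a z = 0"
  obtains w where "w \<in> lists letters" "word_charge w = a"
proof -
  obtain w where w: "w \<in> lists letters" "\<And>z. word_charge w z = - max 0 (- a z)"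
    using ex_nonpos_word_charge[of "\<lambda>z. max 0 (- a z)"] assms by auto
  define s where "s = inv_into UNIV (word_perm w)"
  have s: "s (word_perm w z) = z" "word_perm w (s z) = z" for z
    using bij_word_perm[OF w(1)] by (auto simp: s_def bij_def surj_f_inv_f)
  have "s z \<in> X \<longleftrightarrow> z \<in> X" for z
    using word_perm_mem_iff[OF w(1), of "s z"] s by simp
  then obtain u where u: "u \<in> lists X" "word_charge (pos u) = (\<lambda>z. max 0 (a (s z)))"
    using ex_pos_word_charge[of "\<lambda>z. max 0 (a (s z))"] assms by auto
  have "word_charge (w @ pos u) z = a z" for z
    using w u s by (simp add: word_charge_append)
  then show ?thesis using w u by (intro that[of "w @ pos u"]) auto
qed

lemma cong_refl [simp]: "w \<in> lists letters \<Longrightarrow> w \<approx> w"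
  by (simp add: cong_def word_cong.refl)

lemma cong_sym: "u \<approx> v \<Longrightarrow> v \<approx> u"
  by (simp add: cong_def word_cong.sym)

lemma cong_trans [trans]: "u \<approx> v \<Longrightarrow> v \<approx> w \<Longrightarrow> u \<approx> w"
  unfolding cong_def by (rule word_cong.trans)

lemma cong_context:
  "u \<approx> v \<Longrightarrow> p \<in> lists letters \<Longrightarrow> q \<in> lists letters \<Longrightarrow> p @ u @ q \<approx> p @ v @ q"
  unfolding cong_def by (rule word_cong_context)

lemma cong_append: "u \<approx> u' \<Longrightarrow> v \<approx> v' \<Longrightarrow> u @ v \<approx> u' @ v'"
  unfolding cong_def by (rule word_cong_append)

lemma cong_Cons: "l \<in> letters \<Longrightarrow> u \<approx> v \<Longrightarrow> l # u \<approx> l # v"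
  using cong_context[of u v "[l]" "[]"] by simp

lemma cong_rel: "(u, v) \<in> rels \<Longrightarrow> u \<in> lists letters \<Longrightarrow> v \<in> lists letters \<Longrightarrow> u \<approx> v"
  using word_cong.rel[of u v rels letters "[]" "[]"] by (simp add: cong_def)

lemma cong_square:
  assumes "x \<in> X" "y \<in> X"
  shows "[(x, True), (star x y, True)] \<approx> [(y, True), (star y x, True)]"
proof (rule cong_rel)
  have "([x, star x y], [y, star y x]) \<in> structure_relations X S"
    using assms by (auto simp: structure_relations_def S_eq)
  then show "([(x, True), (star x y, True)], [(y, True), (star y x, True)]) \<in> rels"
    by (force simp: group_relations_def)
qed (use assms in auto)

lemma cong_cancel: "x \<in> X \<Longrightarrow> [(x, b), (x, \<not> b)] \<approx> []"
  by (rule cong_rel) (auto simp: group_relations_def)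

lemma pos_neg_cancel: "u \<in> lists X \<Longrightarrow> pos (rev u) @ neg u \<approx> []"
  and neg_pos_cancel: "u \<in> lists X \<Longrightarrow> neg u @ pos (rev u) \<approx> []"
proof (induction u)
  case (Cons x u)
  {
    case 1
    have "pos (rev (x # u)) @ neg (x # u) = pos (rev u) @ [(x, True), (x, False)] @ neg u" by simp
    also have "\<dots> \<approx> pos (rev u) @ [] @ neg u"
      using 1 cong_cancel[of x True] by (intro cong_context) auto
    also have "\<dots> \<approx> []" using Cons 1 by simp
    finally show ?case .
  next
    case 2
    have "neg (x # u) @ pos (rev (x # u)) = [(x, False)] @ (neg u @ pos (rev u)) @ [(x, True)]" by simp
    also have "\<dots> \<approx> [(x, False)] @ [] @ [(x, True)]"
      using 2 Cons by (intro cong_context) auto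
    also have "\<dots> \<approx> []" using 2 cong_cancel[of x False] by simp
    finally show ?case .
  }
qed simp_all

lemma sum_word_charge_pos:
  "u \<in> lists X \<Longrightarrow> (\<Sum>z\<in>X. word_charge (pos u) z) = int (length u)"
proof (induction u)
  case (Cons x u)
  have "word_perm [(x, True)] = star x" by (simp add: fun_eq_iff)
  then have "(\<Sum>z\<in>X. word_charge (pos u) (star x z)) = (\<Sum>z\<in>X. word_charge (pos u) z)"
    using bij_word_perm_X[of "[(x, True)]"] Cons.prems by (intro sum.reindex_bij_betw) simp
  moreover have "(\<Sum>z\<in>X. of_bool (z = x)) = (1::int)"
    using Cons.prems finite_X by (simp add: of_bool_def)
  ultimately show ?case using Cons by (simp add: sum.distrib)
qed simp

text \<open>If words \<open>x u'\<close> and \<open>y v'\<close> with \<open>x \<noteq> y\<close> have the same charge, then this charge is at least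
  \<open>1\<close> at \<open>x\<close> and at \<open>y\<close>, so it is also the charge of some \<open>x (star x y) w\<close>. By induction the latter is
  congruent to \<open>x u'\<close>, and, after one application of the relation for \<open>x\<close> and \<open>y\<close>, to \<open>y v'\<close>.\<close>

lemma pos_cong_of_charge_eq:
  assumes "u \<in> lists X" "v \<in> lists X" "word_charge (pos u) = word_charge (pos v)"
  shows "pos u \<approx> pos v"
  using assms
proof (induction "length u" arbitrary: u v)
  case 0
  then have "int (length v) = int (length u)"
    using sum_word_charge_pos[of u] sum_word_charge_pos[of v] by metis
  then show ?case using 0 by simp
next
  case (Suc n)
  have len: "length v = Suc n"
    using sum_word_charge_pos[of u] sum_word_charge_pos[of v] Suc by simp
  obtain x u' y v' where u: "u = x # u'" and v: "v = y # v'"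
    using Suc(2) len by (cases u; cases v) auto
  have X: "x \<in> X" "y \<in> X" "u' \<in> lists X" "v' \<in> lists X" using Suc.prems u v by auto
  have tail: "pos u' \<approx> pos w"
    if w: "w \<in> lists X" "word_charge (pos (x # w)) = word_charge (pos (x # u'))" for w
  proof -
    have "word_charge (pos u') (star x z) = word_charge (pos w) (star x z)" for z
      using fun_cong[OF w(2), of z] by simp
    then have "word_charge (pos u') = word_charge (pos w)"
      using X(1) by (metis act_star star_act ext)
    then show ?thesis using Suc X w u by simp
  qed
  show ?case
  proof (cases "x = y")
    case True
    then show ?thesis using tail[of v'] Suc.prems u v X by (auto intro: cong_Cons)
  next
    case False
    define a where "a = star x y"
    define b where "b = star y x"
    define p where "p = word_perm [(x, True), (a, True)]"
    have ab: "a \<in> X" "b \<in> X" using X by (auto simp: a_def b_def)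
    have square: "[(x, True), (a, True)] \<approx> [(y, True), (b, True)]"
      using cong_square X by (simp add: a_def b_def)
    have p: "bij p" unfolding p_def by (rule bij_word_perm) (use X ab in auto)
    \<comment> \<open>what remains of the charge after the prefix \<open>x a\<close>, to be realized by a word \<open>w\<close>\<close>
    define c where "c z = word_charge (pos u) z - of_bool (z = x) - of_bool (z = y)" for z
    have "1 \<le> word_charge (pos u) x" "1 \<le> word_charge (pos v) y"
      using word_charge_pos_nonneg[of u' "star x x"] word_charge_pos_nonneg[of v' "star y y"]
      by (auto simp: u v)
    then have c: "0 \<le> c z" "z \<notin> X \<Longrightarrow> c z = 0" for z
      using word_charge_pos_nonneg[of u z] False X Suc.prems
      by (auto simp: c_def word_charge_outside)
    define s where "s = inv_into UNIV p"
    have s: "s (p z) = z" "p (s z) = z" for z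
      using p by (auto simp: s_def bij_def surj_f_inv_f)
    have "p z \<in> X \<longleftrightarrow> z \<in> X" for z unfolding p_def using X ab by (intro word_perm_mem_iff) auto
    then have "s z \<in> X \<longleftrightarrow> z \<in> X" for z using s by metis
    then obtain w where w: "w \<in> lists X" "word_charge (pos w) = (\<lambda>z. c (s z))"
      using ex_pos_word_charge[of "\<lambda>z. c (s z)"] c by auto
    have xa: "word_charge (pos (x # a # w)) = word_charge (pos u)"
    proof
      fix z
      have "word_charge (pos (x # a # w)) z
          = word_charge [(x, True), (a, True)] z + word_charge (pos w) (p z)"
        by (simp add: p_def)
      also have "\<dots> = word_charge (pos u) z"
        using s X(1) by (simp add: w c_def a_def)
      finally show "word_charge (pos (x # a # w)) z = word_charge (pos u) z" .
    qed
    have sq_w: "pos (x # a # w) \<approx> pos (y # b # w)"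
      using cong_append[OF square cong_refl[OF pos_letters[OF w(1)]]] by simp
    then have yb: "word_charge (pos (y # b # w)) = word_charge (pos v)"
      using xa Suc.prems(3) cong_invariance by metis
    have "pos u' \<approx> pos (a # w)" using tail[of "a # w"] xa u w ab by auto
    then have "pos u \<approx> pos (x # a # w)" unfolding u using X cong_Cons by auto
    also note sq_w
    also have "pos (y # b # w) \<approx> pos v"
    proof -
      have "x # a # w \<in> lists X" using X ab w by simp
      then have "int (length (x # a # w)) = int (length u)"
        using sum_word_charge_pos[of "x # a # w"] sum_word_charge_pos[of u] Suc.prems(1) unfolding xa
        by metis
      then have "length (b # w) = n" using Suc(2) by simp
      moreover have "word_charge (pos (b # w)) = word_charge (pos v')"
      proof -
        have "word_charge (pos (b # w)) (star y z) = word_charge (pos v') (star y z)" for z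
          using fun_cong[OF yb, of z] by (simp add: v)
        then show ?thesis using X(2) by (metis act_star star_act ext)
      qed
      ultimately have "pos (b # w) \<approx> pos v'" using Suc(1)[of "b # w" v'] X w ab by auto
      then show ?thesis unfolding v using X cong_Cons by auto
    qed
    finally show ?thesis .
  qed
qed

text \<open>Writing \<open>x = star a b\<close> and \<open>y = star b a\<close> gives \<open>a x = b y\<close>, that is,
  \<open>x y\<inverse> = a\<inverse> b\<close>: a positive letter moves to the right past an inverse letter.\<close>

lemma push_pos_through_neg:
  "u \<in> lists X \<Longrightarrow> x \<in> X \<Longrightarrow>
    \<exists>u' \<in> lists X. \<exists>x' \<in> X. (x, True) # neg u \<approx> neg u' @ [(x', True)]"
proof (induction u arbitrary: x)
  case Nil
  then show ?case by (intro bexI[of _ "[]"] bexI[of _ x]) auto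
next
  case (Cons y u)
  then have y: "y \<in> X" "u \<in> lists X" by auto
  obtain a b where ab: "a \<in> X" "b \<in> X" "star a b = x" "star b a = y"
    using ex_star_pair[OF Cons.prems(2) y(1)] by metis
  obtain u' x' where u': "u' \<in> lists X" "x' \<in> X" "(b, True) # neg u \<approx> neg u' @ [(x', True)]"
    using Cons.IH[OF y(2) ab(2)] by auto
  have "[] @ [(x, True), (y, False)] @ neg u \<approx> [(a, False), (a, True)] @ [(x, True), (y, False)] @ neg u"
    using cong_cancel[of a False] ab y Cons.prems by (intro cong_append cong_sym[of _ "[]"] cong_refl) auto
  also have "\<dots> = [(a, False)] @ [(a, True), (x, True)] @ ((y, False) # neg u)" by simp
  also have "\<dots> \<approx> [(a, False)] @ [(b, True), (y, True)] @ ((y, False) # neg u)"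
    using cong_square[of a b] ab y by (intro cong_context) auto
  also have "\<dots> = [(a, False), (b, True)] @ [(y, True), (y, False)] @ neg u" by simp
  also have "\<dots> \<approx> [(a, False), (b, True)] @ [] @ neg u"
    using cong_cancel[of y True] ab y by (intro cong_context) auto
  also have "\<dots> = (a, False) # (b, True) # neg u" by simp
  also have "\<dots> \<approx> (a, False) # neg u' @ [(x', True)]"
    using u' ab by (intro cong_Cons) auto
  finally show ?case using u' ab by (intro bexI[of _ "a # u'"] bexI[of _ x']) auto
qed

lemma left_fraction:
  "w \<in> lists letters \<Longrightarrow> \<exists>u \<in> lists X. \<exists>v \<in> lists X. w \<approx> neg u @ pos v"
proof (induction w)
  case Nil
  then show ?case by (intro bexI[of _ "[]"]) auto
next
  case (Cons l w)
  obtain x c where l: "l = (x, c)" "x \<in> X" using Cons.prems by (cases l) auto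
  obtain u v where uv: "u \<in> lists X" "v \<in> lists X" "w \<approx> neg u @ pos v"
    using Cons.IH Cons.prems by auto
  have lw: "l # w \<approx> (x, c) # neg u @ pos v" unfolding l using uv l by (intro cong_Cons) auto
  show ?case
  proof (cases c)
    case True
    obtain u' x' where u': "u' \<in> lists X" "x' \<in> X" "(x, True) # neg u \<approx> neg u' @ [(x', True)]"
      using push_pos_through_neg[OF uv(1) l(2)] by blast
    have "l # w \<approx> ((x, True) # neg u) @ pos v" using lw True by simp
    also have "\<dots> \<approx> (neg u' @ [(x', True)]) @ pos v"
      using u' uv by (intro cong_append) auto
    finally show ?thesis using u' uv by (intro bexI[of _ u'] bexI[of _ "x' # v"]) auto
  next
    case False
    then show ?thesis using lw uv l by (intro bexI[of _ "x # u"] bexI[of _ v]) auto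
  qed
qed

text \<open>Kernel of the charge: for a left fraction \<open>u\<inverse> v\<close> of charge zero the positive words \<open>u\<close> and
  \<open>v\<close> have the same charge, hence are congruent. Here \<open>neg u\<close> is the inverse of \<open>pos (rev u)\<close>.\<close>

lemma cong_Nil_of_charge_zero:
  assumes "w \<in> lists letters" "\<And>z. word_charge w z = 0"
  shows "w \<approx> []"
proof -
  obtain u v where uv: "u \<in> lists X" "v \<in> lists X" "w \<approx> neg u @ pos v"
    using left_fraction[OF assms(1)] by blast
  have ru: "rev u \<in> lists X" using uv by auto
  have "pos (rev u) @ w \<approx> pos (rev u) @ neg u @ pos v"
    using uv ru by (intro cong_append) auto
  also have "\<dots> = (pos (rev u) @ neg u) @ pos v" by simp
  also have "\<dots> \<approx> [] @ pos v" using uv pos_neg_cancel by (intro cong_append) auto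
  finally have "word_charge (pos (rev u) @ w) = word_charge (pos v)" using cong_invariance by simp
  then have "word_charge (pos (rev u)) = word_charge (pos v)"
    by (simp add: fun_eq_iff word_charge_append assms)
  then have eq: "pos (rev u) \<approx> pos v" using pos_cong_of_charge_eq uv ru by blast
  note uv(3)
  also have "neg u @ pos v \<approx> neg u @ pos (rev u)"
    using uv eq cong_sym by (intro cong_append) auto
  also have "\<dots> \<approx> []" using neg_pos_cancel uv by blast
  finally show ?thesis .
qed

abbreviation "grp \<equiv> structure_group X S"

abbreviation cls :: "('a \<times> bool) list \<Rightarrow> ('a \<times> bool) list set" where
  "cls w \<equiv> word_cong letters rels `` {w}"

lemma grp_eq: "grp = presented_monoid letters rels"
  by (simp add: structure_group_def presented_group_def)

text \<open>The choice of a representative does not matter, by \<open>cong_invariance\<close>.\<close>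

definition charge :: "('a \<times> bool) list set \<Rightarrow> 'a \<Rightarrow> int" where
  "charge A = word_charge (SOME w. w \<in> A)"

definition perm :: "('a \<times> bool) list set \<Rightarrow> 'a \<Rightarrow> 'a" where
  "perm A = word_perm (SOME w. w \<in> A)"

lemma charge_cls: "w \<in> lists letters \<Longrightarrow> charge (cls w) = word_charge w"
  and perm_cls: "w \<in> lists letters \<Longrightarrow> perm (cls w) = word_perm w"
proof -
  assume "w \<in> lists letters"
  then have "w \<in> cls w" by (simp add: word_cong.refl)
  then have "(SOME v. v \<in> cls w) \<in> cls w" by (rule someI)
  then have "w \<approx> (SOME v. v \<in> cls w)" by (simp add: cong_def)
  then show "charge (cls w) = word_charge w" "perm (cls w) = word_perm w"
    using cong_invariance by (simp_all add: charge_def perm_def)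
qed

lemma cls_eq: "u \<approx> v \<Longrightarrow> cls u = cls v"
  unfolding cong_def by (rule equiv_class_eq[OF equiv_word_cong])

lemma grp_mult: "u \<in> lists letters \<Longrightarrow> v \<in> lists letters \<Longrightarrow> cls u \<otimes>\<^bsub>grp\<^esub> cls v = cls (u @ v)"
  unfolding grp_eq by (rule presented_monoid_mult)

lemma grp_carrier: "carrier grp = cls ` lists letters"
  by (auto simp: grp_eq presented_monoid_def quotient_def)

lemma charge_kernel:
  assumes "p \<in> carrier grp" "\<And>z. charge p z = 0"
  shows "p = \<one>\<^bsub>grp\<^esub>"
proof -
  obtain w where w: "w \<in> lists letters" "p = cls w" using assms(1) by (auto simp: grp_carrier)
  then have "w \<approx> []" using assms(2) cong_Nil_of_charge_zero by (simp add: charge_cls)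
  then show ?thesis using w cls_eq by (simp add: grp_eq presented_monoid_def)
qed

lemma structure_group_bijective_cocycle: "bijective_cocycle grp X charge perm"
proof -
  interpret group grp unfolding structure_group_def by (rule group_presented_group)
  have mult: "charge (p \<otimes>\<^bsub>grp\<^esub> q) z = charge p z + charge q (perm p z)"
    if "p \<in> carrier grp" "q \<in> carrier grp" for p q z
    using that by (auto simp: grp_carrier grp_mult charge_cls perm_cls word_charge_append)
  have surj: "surj (perm p)" "bij_betw (perm p) X X" if "p \<in> carrier grp" for p
    using that bij_word_perm bij_word_perm_X
    by (auto simp: grp_carrier perm_cls bij_def)
  have "bij_betw charge (carrier grp) {a. \<forall>z. z \<notin> X \<longrightarrow> a z = 0}"
  proof (rule bij_betw_imageI)
    show "inj_on charge (carrier grp)"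
    proof (rule inj_onI)
      fix p q assume pq: "p \<in> carrier grp" "q \<in> carrier grp" "charge p = charge q"
      define r where "r = inv\<^bsub>grp\<^esub> p \<otimes>\<^bsub>grp\<^esub> q"
      have r: "r \<in> carrier grp" "q = p \<otimes>\<^bsub>grp\<^esub> r" using pq by (auto simp: r_def m_assoc[symmetric])
      have "charge r z = 0" for z
      proof -
        obtain y where "z = perm p y" using surj(1)[OF pq(1)] by auto
        then show ?thesis using mult[OF pq(1) r(1), of y] r(2) pq(3) by simp
      qed
      then have "r = \<one>\<^bsub>grp\<^esub>" using charge_kernel r by blast
      then show "p = q" using r pq by simp
    qed
    show "charge ` carrier grp = {a. \<forall>z. z \<notin> X \<longrightarrow> a z = 0}"
    proof (intro subset_antisym subsetI)
      fix a assume "a \<in> charge ` carrier grp"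
      then show "a \<in> {a. \<forall>z. z \<notin> X \<longrightarrow> a z = 0}"
        by (auto simp: grp_carrier charge_cls word_charge_outside)
    next
      fix a :: "'a \<Rightarrow> int" assume "a \<in> {a. \<forall>z. z \<notin> X \<longrightarrow> a z = 0}"
      then obtain w where "w \<in> lists letters" "word_charge w = a" using ex_word_charge[of a] by auto
      then show "a \<in> charge ` carrier grp"
        by (auto simp: grp_carrier charge_cls image_iff intro!: bexI[of _ w])
    qed
  qed
  then show ?thesis
    by unfold_locales (auto simp: finite_X surj mult)
qed

theorem garside_structure_group: "garside_group grp"
  using bijective_cocycle.garside_group[OF structure_group_bijective_cocycle] .

end

section \<open>Quadratic presentations of Garside monoids\<close>

lemma word_cong_mono:
  assumes "\<And>u v. (u, v) \<in> R \<Longrightarrow> u \<in> lists X \<Longrightarrow> v \<in> lists X \<Longrightarrow> (u, v) \<in> word_cong X R'"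
  shows "word_cong X R \<subseteq> word_cong X R'"
proof (rule subrelI)
  fix u v assume "(u, v) \<in> word_cong X R"
  then show "(u, v) \<in> word_cong X R'"
  proof (induction rule: word_cong.induct)
    case (rel u v p q)
    then show ?case using assms word_cong_context by metis
  qed (auto intro: word_cong.refl word_cong.sym word_cong.trans)
qed

text \<open>Counting shows that exactly one element is left over to be mapped to \<open>x\<close>.\<close>

lemma bij_betw_of_unique_preimages:
  assumes "finite X" "x \<in> X" "h ` X \<subseteq> X"
    and unique: "\<And>t. t \<in> X \<Longrightarrow> t \<noteq> x \<Longrightarrow> \<exists>!y. y \<in> X \<and> h y = t"
  shows "bij_betw h X X"
proof -
  let ?Y = "{y \<in> X. h y \<noteq> x}"
  have "inj_on h ?Y"
    using assms(3) unique by (intro inj_onI) (metis (mono_tags, lifting) image_subset_iff mem_Collect_eq)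
  moreover have "h ` ?Y = X - {x}"
  proof (intro subset_antisym subsetI)
    fix t assume "t \<in> X - {x}"
    then show "t \<in> h ` ?Y" using unique[of t] by auto
  qed (use assms(3) in auto)
  ultimately have "card ?Y = card (X - {x})" by (metis card_image)
  then have "?Y \<noteq> X" using assms by (metis card_Diff1_less less_irrefl)
  then have "x \<in> h ` X" by auto
  with \<open>h ` ?Y = X - {x}\<close> have "h ` X = X" using assms(3) by auto
  then show ?thesis using assms(1) by (simp add: bij_betw_def eq_card_imp_inj_on)
qed

locale quadratic_garside_presentation =
  fixes X :: "'a set" and R :: "('a list \<times> 'a list) set"
  assumes R_words: "R \<subseteq> lists X \<times> lists X"
    and garside: "garside_monoid (presented_monoid X R)"
    and finite_X: "finite X"
    and card_R: "card R = card X * (card X - 1) div 2"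
    and quadratic: "\<And>u v. (u, v) \<in> R \<Longrightarrow> length u = 2 \<and> length v = 2"
    and once: "sides_appear_once R"
begin

declare in_lists_conv_set [simp del] in_listsD [rule del] in_listsI [rule del]

abbreviation "M \<equiv> presented_monoid X R"
abbreviation "cls w \<equiv> word_cong X R `` {w}"

definition cong :: "'a list \<Rightarrow> 'a list \<Rightarrow> bool" (infix "\<approx>" 50) where
  "u \<approx> v \<longleftrightarrow> (u, v) \<in> word_cong X R"

lemma cong_refl [simp]: "w \<in> lists X \<Longrightarrow> w \<approx> w"
  by (simp add: cong_def word_cong.refl)

lemma cong_sym: "u \<approx> v \<Longrightarrow> v \<approx> u"
  by (simp add: cong_def word_cong.sym)

lemma cong_trans [trans]: "u \<approx> v \<Longrightarrow> v \<approx> w \<Longrightarrow> u \<approx> w"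
  unfolding cong_def by (rule word_cong.trans)

lemma cong_lists: "u \<approx> v \<Longrightarrow> u \<in> lists X" "u \<approx> v \<Longrightarrow> v \<in> lists X"
  unfolding cong_def by (blast dest: word_cong_lists)+

lemma cong_append: "u \<approx> u' \<Longrightarrow> v \<approx> v' \<Longrightarrow> u @ v \<approx> u' @ v'"
  unfolding cong_def by (rule word_cong_append)

lemma cong_length: "u \<approx> v \<Longrightarrow> length u = length v"
  unfolding cong_def by (induction rule: word_cong.induct) (simp_all add: quadratic)

lemma cong_short: "u \<approx> v \<Longrightarrow> u = v \<or> 2 \<le> length u \<and> 2 \<le> length v"
  unfolding cong_def
proof (induction rule: word_cong.induct)
  case (rel u v p q)
  then show ?case using quadratic[of u v] by simp
qed blast+

lemma cong_letters: "[x] \<approx> [y] \<Longrightarrow> x = y"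
  using cong_short[of "[x]" "[y]"] by simp

lemma cls_eq_iff: "u \<in> lists X \<Longrightarrow> v \<in> lists X \<Longrightarrow> cls u = cls v \<longleftrightarrow> u \<approx> v"
  unfolding cong_def using equiv_word_cong by (metis eq_equiv_class_iff)

lemma gaussian: "gaussian_monoid M"
  using garside by (simp add: garside_monoid_def)

lemma cancel_left: "w @ u \<approx> w @ v \<Longrightarrow> u \<approx> v"
proof -
  assume "w @ u \<approx> w @ v"
  moreover from this have X: "w \<in> lists X" "u \<in> lists X" "v \<in> lists X"
    using cong_lists by (metis append_in_lists_conv)+
  ultimately have "cls w \<otimes>\<^bsub>M\<^esub> cls u = cls w \<otimes>\<^bsub>M\<^esub> cls v"
    by (simp add: presented_monoid_mult cls_eq_iff)
  then have "cls u = cls v"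
    using gaussian X monoid_cancel.l_cancel[of M] by (meson gaussian_monoid_def presented_monoid_carrierI)
  then show "u \<approx> v" using X by (simp add: cls_eq_iff)
qed

lemma cancel_right: "u @ w \<approx> v @ w \<Longrightarrow> u \<approx> v"
proof -
  assume "u @ w \<approx> v @ w"
  moreover from this have X: "w \<in> lists X" "u \<in> lists X" "v \<in> lists X"
    using cong_lists by (metis append_in_lists_conv)+
  ultimately have "cls u \<otimes>\<^bsub>M\<^esub> cls w = cls v \<otimes>\<^bsub>M\<^esub> cls w"
    by (simp add: presented_monoid_mult cls_eq_iff)
  then have "cls u = cls v"
    using gaussian X monoid_cancel.r_cancel[of M] by (meson gaussian_monoid_def presented_monoid_carrierI)
  then show "u \<approx> v" using X by (simp add: cls_eq_iff)
qed

lemma left_divides_cls: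
  assumes "p \<in> lists X" "w \<in> lists X"
  shows "left_divides M (cls p) (cls w) \<longleftrightarrow> (\<exists>s \<in> lists X. w \<approx> p @ s)"
proof
  assume "left_divides M (cls p) (cls w)"
  then obtain t where "t \<in> carrier M" "cls w = cls p \<otimes>\<^bsub>M\<^esub> t" by (auto simp: left_divides_def)
  moreover from this obtain s where "s \<in> lists X" "t = cls s" by (meson presented_monoid_carrierE)
  ultimately show "\<exists>s \<in> lists X. w \<approx> p @ s"
    using assms by (auto simp: presented_monoid_mult cls_eq_iff)
next
  assume "\<exists>s \<in> lists X. w \<approx> p @ s"
  then obtain s where s: "s \<in> lists X" "w \<approx> p @ s" by blast
  then have "cls w = cls p \<otimes>\<^bsub>M\<^esub> cls s" using assms by (simp add: presented_monoid_mult cls_eq_iff)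
  then show "left_divides M (cls p) (cls w)"
    using s(1) by (auto simp: left_divides_def intro: presented_monoid_carrierI)
qed

lemma right_divides_cls:
  assumes "p \<in> lists X" "w \<in> lists X"
  shows "right_divides M (cls p) (cls w) \<longleftrightarrow> (\<exists>s \<in> lists X. w \<approx> s @ p)"
proof
  assume "right_divides M (cls p) (cls w)"
  then obtain t where "t \<in> carrier M" "cls w = t \<otimes>\<^bsub>M\<^esub> cls p" by (auto simp: right_divides_def)
  moreover from this obtain s where "s \<in> lists X" "t = cls s" by (meson presented_monoid_carrierE)
  ultimately show "\<exists>s \<in> lists X. w \<approx> s @ p"
    using assms by (auto simp: presented_monoid_mult cls_eq_iff)
next
  assume "\<exists>s \<in> lists X. w \<approx> s @ p"
  then obtain s where s: "s \<in> lists X" "w \<approx> s @ p" by blast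
  then have "cls w = cls s \<otimes>\<^bsub>M\<^esub> cls p" using assms by (simp add: presented_monoid_mult cls_eq_iff)
  then show "right_divides M (cls p) (cls w)"
    using s(1) by (auto simp: right_divides_def intro: presented_monoid_carrierI)
qed

lemma right_lcm_word:
  assumes "p \<in> lists X" "q \<in> lists X"
  obtains u p' q' where "u \<approx> p @ p'" "u \<approx> q @ q'"
    "\<And>w r s. w \<approx> p @ r \<Longrightarrow> w \<approx> q @ s \<Longrightarrow> \<exists>t. w \<approx> u @ t"
proof -
  obtain d where d: "is_right_lcm M d (cls p) (cls q)"
    using gaussian assms by (meson gaussian_monoid_def presented_monoid_carrierI)
  then obtain u where u: "u \<in> lists X" "d = cls u"
    unfolding is_right_lcm_def by (meson presented_monoid_carrierE)
  have "\<exists>t. w \<approx> u @ t" if "w \<approx> p @ r" "w \<approx> q @ s" for w r s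
  proof -
    have "w \<in> lists X" "r \<in> lists X" "s \<in> lists X"
      using cong_lists[OF that(1)] cong_lists[OF that(2)] by auto
    then have "left_divides M (cls u) (cls w)"
      using d that assms u unfolding is_right_lcm_def
      by (metis left_divides_cls presented_monoid_carrierI)
    then show ?thesis using u \<open>w \<in> lists X\<close> left_divides_cls by blast
  qed
  moreover have "left_divides M (cls p) (cls u)" "left_divides M (cls q) (cls u)"
    using d u by (simp_all add: is_right_lcm_def)
  ultimately show ?thesis using that assms u left_divides_cls by metis
qed

lemma left_lcm_word:
  assumes "p \<in> lists X" "q \<in> lists X"
  obtains u p' q' where "u \<approx> p' @ p" "u \<approx> q' @ q"
    "\<And>w r s. w \<approx> r @ p \<Longrightarrow> w \<approx> s @ q \<Longrightarrow> \<exists>t. w \<approx> t @ u"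
proof -
  obtain d where d: "is_left_lcm M d (cls p) (cls q)"
    using gaussian assms by (meson gaussian_monoid_def presented_monoid_carrierI)
  then obtain u where u: "u \<in> lists X" "d = cls u"
    unfolding is_left_lcm_def by (meson presented_monoid_carrierE)
  have "\<exists>t. w \<approx> t @ u" if "w \<approx> r @ p" "w \<approx> s @ q" for w r s
  proof -
    have "w \<in> lists X" "r \<in> lists X" "s \<in> lists X"
      using cong_lists[OF that(1)] cong_lists[OF that(2)] by auto
    then have "right_divides M (cls u) (cls w)"
      using d that assms u unfolding is_left_lcm_def
      by (metis right_divides_cls presented_monoid_carrierI)
    then show ?thesis using u \<open>w \<in> lists X\<close> right_divides_cls by blast
  qed
  moreover have "right_divides M (cls p) (cls u)" "right_divides M (cls q) (cls u)"
    using d u by (simp_all add: is_left_lcm_def)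
  ultimately show ?thesis using that assms u right_divides_cls by metis
qed

text \<open>If \<open>q\<close> does not divide \<open>p\<close>, then a common right multiple of \<open>p\<close> and \<open>q\<close> that is only one letter
  longer than \<open>p\<close> must be their right lcm, since relations preserve length.\<close>

lemma minimal_right_multiple_unique:
  assumes "\<And>s. \<not> p \<approx> q @ s" "q \<in> lists X"
    and "w \<approx> p @ [a]" "w \<approx> q @ r" and "w' \<approx> p @ [a']" "w' \<approx> q @ r'"
  shows "a = a'"
proof -
  have "p \<in> lists X" using cong_lists(2)[OF assms(3)] by simp
  then obtain u p' q' where u: "u \<approx> p @ p'" "u \<approx> q @ q'"
    "\<And>w r s. w \<approx> p @ r \<Longrightarrow> w \<approx> q @ s \<Longrightarrow> \<exists>t. w \<approx> u @ t"
    using right_lcm_word assms(2) by metis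
  have "p' \<noteq> []" using assms(1) u(1,2) cong_sym cong_trans by (metis append_Nil2)
  have eq: "v \<approx> u" if "v \<approx> p @ [b]" "v \<approx> q @ s" for v b s
  proof -
    obtain t where t: "v \<approx> u @ t" using u(3) \<open>v \<approx> p @ [b]\<close> \<open>v \<approx> q @ s\<close> by blast
    have "length p + 1 = length p + length p' + length t"
      using cong_length[OF t] cong_length[OF that(1)] cong_length[OF u(1)] by simp
    with \<open>p' \<noteq> []\<close> have "t = []" by (cases p') auto
    then show ?thesis using t by simp
  qed
  have "p @ [a] \<approx> p @ [a']"
    using eq[OF assms(3,4)] eq[OF assms(5,6)] assms(3,5) cong_sym cong_trans by metis
  then show ?thesis by (rule cong_letters[OF cancel_left])
qed

text \<open>The mirror image of the previous lemma; it takes care of the last letters of relations, and thus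
  of the maps \<open>f x\<close>.\<close>

lemma minimal_left_multiple_unique:
  assumes "\<And>s. \<not> p \<approx> s @ q" "q \<in> lists X"
    and "w \<approx> [a] @ p" "w \<approx> r @ q" and "w' \<approx> [a'] @ p" "w' \<approx> r' @ q"
  shows "a = a'"
proof -
  have "p \<in> lists X" using cong_lists(2)[OF assms(3)] by simp
  then obtain u p' q' where u: "u \<approx> p' @ p" "u \<approx> q' @ q"
    "\<And>w r s. w \<approx> r @ p \<Longrightarrow> w \<approx> s @ q \<Longrightarrow> \<exists>t. w \<approx> t @ u"
    using left_lcm_word assms(2) by metis
  have "p' \<noteq> []" using assms(1) u(1,2) cong_sym cong_trans by (metis append_Nil)
  have eq: "v \<approx> u" if "v \<approx> [b] @ p" "v \<approx> s @ q" for v b s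
  proof -
    obtain t where t: "v \<approx> t @ u" using u(3) \<open>v \<approx> [b] @ p\<close> \<open>v \<approx> s @ q\<close> by blast
    have "length p + 1 = length p + length p' + length t"
      using cong_length[OF t] cong_length[OF that(1)] cong_length[OF u(1)] by simp
    with \<open>p' \<noteq> []\<close> have "t = []" by (cases p') auto
    then show ?thesis using t by simp
  qed
  have "[a] @ p \<approx> [a'] @ p"
    using eq[OF assms(3,4)] eq[OF assms(5,6)] assms(3,5) cong_sym cong_trans by metis
  then show ?thesis by (rule cong_letters[OF cancel_right])
qed

lemma letter_not_multiple: "x \<noteq> t \<Longrightarrow> \<not> [x] \<approx> [t] @ s" "x \<noteq> t \<Longrightarrow> \<not> [x] \<approx> s @ [t]"
  using cong_length[of "[x]" "[t] @ s"] cong_length[of "[x]" "s @ [t]"] cong_letters[of x t] by auto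

lemma right_complement_unique:
  assumes "x \<noteq> t" "[x, y] \<approx> [t, z]" "[x, y'] \<approx> [t, z']"
  shows "y = y'"
proof (rule minimal_right_multiple_unique[of "[x]" "[t]" "[x, y]" _ "[z]" "[x, y']" _ "[z']"])
  show "\<not> [x] \<approx> [t] @ s" for s using letter_not_multiple assms(1) by blast
qed (use assms cong_lists[OF assms(2)] cong_lists[OF assms(3)] in auto)

lemma left_complement_unique:
  assumes "y \<noteq> z" "[x, y] \<approx> [t, z]" "[x', y] \<approx> [t', z]"
  shows "x = x'"
proof (rule minimal_left_multiple_unique[of "[y]" "[z]" "[x, y]" _ "[t]" "[x', y]" _ "[t']"])
  show "\<not> [y] \<approx> s @ [z]" for s using letter_not_multiple assms(1) by blast
qed (use assms cong_lists[OF assms(2)] cong_lists[OF assms(3)] in auto)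

text \<open>An occurrence is a relation with a choice of one of its sides. Counting occurrences instead
  of relations turns \<open>n (n - 1) / 2\<close> unordered pairs of letters into \<open>n (n - 1)\<close> ordered ones.\<close>

definition side :: "('a list \<times> 'a list) \<times> bool \<Rightarrow> 'a list" where
  "side = (\<lambda>(r, b). if b then fst r else snd r)"

definition other_side :: "('a list \<times> 'a list) \<times> bool \<Rightarrow> 'a list" where
  "other_side = (\<lambda>(r, b). side (r, \<not> b))"

abbreviation "occurrences \<equiv> R \<times> (UNIV :: bool set)"

definition related :: "'a \<times> 'a \<Rightarrow> 'a \<times> 'a \<Rightarrow> bool" where
  "related = (\<lambda>(x, y) (t, z). ([x, y], [t, z]) \<in> R \<or> ([t, z], [x, y]) \<in> R)"

lemma side_inj: "inj_on side occurrences"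
  using once by (simp add: sides_appear_once_def side_def case_prod_unfold)

lemma related_iff: "related (x, y) (t, z) \<longleftrightarrow>
    (\<exists>p \<in> occurrences. side p = [x, y] \<and> other_side p = [t, z])"
proof -
  have "(\<exists>p \<in> occurrences. side p = [x, y] \<and> other_side p = [t, z])
      \<longleftrightarrow> (\<exists>r \<in> R. \<exists>b. side (r, b) = [x, y] \<and> other_side (r, b) = [t, z])"
    by blast
  also have "\<dots> \<longleftrightarrow> (\<exists>r \<in> R. r = ([x, y], [t, z]) \<or> r = ([t, z], [x, y]))"
    by (simp add: side_def other_side_def ex_bool_eq prod_eq_iff conj_commute)
  finally show ?thesis by (auto simp: related_def)
qed

lemma related_sym: "related p q \<Longrightarrow> related q p"
  by (auto simp: related_def)

lemma related_unique: "related p q \<Longrightarrow> related p q' \<Longrightarrow> q = q'"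
proof -
  assume q: "related p q" "related p q'"
  obtain x y t z t' z' where eq: "p = (x, y)" "q = (t, z)" "q' = (t', z')"
    by (metis prod.collapse)
  obtain r r' where r: "r \<in> occurrences" "side r = [x, y]" "other_side r = [t, z]"
    and r': "r' \<in> occurrences" "side r' = [x, y]" "other_side r' = [t', z']"
    using q unfolding eq related_iff by blast
  have "r = r'" using side_inj r(1,2) r'(1,2) by (metis inj_onD)
  then show ?thesis using r(3) r'(3) eq by simp
qed

lemma related_closed: "related (x, y) (t, z) \<Longrightarrow> x \<in> X \<and> y \<in> X \<and> t \<in> X \<and> z \<in> X"
  using R_words by (auto simp: related_def)

lemma related_cong: "related (x, y) (t, z) \<Longrightarrow> [x, y] \<approx> [t, z]"
proof -
  assume rel: "related (x, y) (t, z)"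
  have "u \<approx> v" if "(u, v) \<in> R" for u v
    using word_cong.rel[OF that, of X "[]" "[]"] that R_words by (auto simp: cong_def)
  then show ?thesis using rel cong_sym by (auto simp: related_def)
qed

text \<open>By cancellation, a relation between words with a common first or last letter would relate a
  word to itself, and such a relation would contain the word twice.\<close>

lemma related_distinct:
  assumes "related (x, y) (t, z)"
  shows "x \<noteq> t" "y \<noteq> z"
proof -
  have irrefl: "\<not> related (x, y) (x, y)" for x y
  proof
    assume "related (x, y) (x, y)"
    then have r: "([x, y], [x, y]) \<in> R" by (simp add: related_def)
    then have "(([x, y], [x, y]), True) = (([x, y], [x, y]), False)"
      by (intro inj_onD[OF side_inj]) (auto simp: side_def)
    then show False by simp
  qed
  note cong = related_cong[OF assms]
  show "x \<noteq> t"
  proof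
    assume "x = t"
    then have "y = z" using cancel_left[of "[x]" "[y]" "[z]"] cong cong_letters by simp
    then show False using irrefl assms \<open>x = t\<close> by simp
  qed
  show "y \<noteq> z"
  proof
    assume "y = z"
    then have "x = t" using cancel_right[of "[x]" "[y]" "[t]"] cong cong_letters by simp
    then show False using irrefl assms \<open>y = z\<close> by simp
  qed
qed

lemma card_occurrences: "card occurrences = card {(x, t). x \<in> X \<and> t \<in> X \<and> x \<noteq> t}"
proof -
  have "{(x, t). x \<in> X \<and> t \<in> X \<and> x \<noteq> t} = (SIGMA x:X. X - {x})" by auto
  then have "card {(x, t). x \<in> X \<and> t \<in> X \<and> x \<noteq> t} = card X * (card X - 1)"
    using finite_X by (simp add: card_SigmaI)
  moreover have "even (card X * (card X - 1))" by auto
  ultimately show ?thesis using card_R by (simp add: card_cartesian_product)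
qed

lemma occurrenceE:
  assumes "p \<in> occurrences"
  obtains x y t z where "side p = [x, y]" "other_side p = [t, z]" "related (x, y) (t, z)"
proof -
  have "length (side p) = 2" "length (other_side p) = 2"
    using assms quadratic by (auto simp: side_def other_side_def)
  then obtain x y t z where "side p = [x, y]" "other_side p = [t, z]"
    by (auto simp: numeral_2_eq_2 length_Suc_conv)
  then show ?thesis using that assms related_iff by blast
qed

text \<open>There are as many occurrences as ordered pairs of distinct letters, so an injective assignment
  of such pairs to occurrences is onto. It is applied with \<open>sel\<close> the first and the last letter of a
  word.\<close>

lemma ex_related_of_inj:
  assumes sel: "\<And>p. p \<in> occurrences \<Longrightarrow> sel (side p) \<noteq> sel (other_side p)"
      "\<And>p. p \<in> occurrences \<Longrightarrow> sel (side p) \<in> X \<and> sel (other_side p) \<in> X"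
    and inj: "inj_on (\<lambda>p. (sel (side p), sel (other_side p))) occurrences"
    and "x \<in> X" "t \<in> X" "x \<noteq> t"
  shows "\<exists>p \<in> occurrences. sel (side p) = x \<and> sel (other_side p) = t"
proof -
  let ?h = "\<lambda>p. (sel (side p), sel (other_side p))" and ?D = "{(x, t). x \<in> X \<and> t \<in> X \<and> x \<noteq> t}"
  have "finite ?D" by (rule finite_subset[of _ "X \<times> X"]) (use finite_X in auto)
  moreover have "?h ` occurrences \<subseteq> ?D" using sel by auto
  moreover have "card (?h ` occurrences) = card ?D" using inj card_occurrences by (simp add: card_image)
  ultimately have "?h ` occurrences = ?D" by (rule card_subset_eq)
  then have "(x, t) \<in> ?h ` occurrences" using assms by auto
  then show ?thesis by auto
qed

lemma ex_related_first:
  assumes "x \<in> X" "t \<in> X" "x \<noteq> t"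
  shows "\<exists>y z. related (x, y) (t, z)"
proof -
  have "\<exists>p \<in> occurrences. hd (side p) = x \<and> hd (other_side p) = t"
  proof (rule ex_related_of_inj)
    show "inj_on (\<lambda>p. (hd (side p), hd (other_side p))) occurrences"
    proof (rule inj_onI)
      fix p q assume pq: "p \<in> occurrences" "q \<in> occurrences"
        "(hd (side p), hd (other_side p)) = (hd (side q), hd (other_side q))"
      obtain x y t z where p: "side p = [x, y]" "other_side p = [t, z]" "related (x, y) (t, z)"
        using occurrenceE[OF pq(1)] .
      obtain x' y' t' z' where q: "side q = [x', y']" "other_side q = [t', z']"
          "related (x', y') (t', z')"
        using occurrenceE[OF pq(2)] .
      have eq: "x' = x" "t' = t" using pq(3) p q by simp_all
      have "y = y'"
        using right_complement_unique[OF related_distinct(1)[OF p(3)] related_cong[OF p(3)]]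
          related_cong[OF q(3)] eq by simp
      then have "side p = side q" using p q eq by simp
      then show "p = q" using side_inj pq(1,2) by (meson inj_onD)
    qed
    fix p assume "p \<in> occurrences"
    then obtain x y t z where p: "side p = [x, y]" "other_side p = [t, z]" "related (x, y) (t, z)"
      by (rule occurrenceE)
    show "hd (side p) \<noteq> hd (other_side p)" "hd (side p) \<in> X \<and> hd (other_side p) \<in> X"
      using p related_distinct[OF p(3)] related_closed[OF p(3)] by simp_all
  qed (fact assms)+
  then obtain p where p: "p \<in> occurrences" "hd (side p) = x" "hd (other_side p) = t" by blast
  show ?thesis by (rule occurrenceE[OF p(1)]) (use p(2,3) in auto)
qed

lemma ex_related_last:
  assumes "y \<in> X" "z \<in> X" "y \<noteq> z"
  shows "\<exists>x t. related (x, y) (t, z)"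
proof -
  have "\<exists>p \<in> occurrences. last (side p) = y \<and> last (other_side p) = z"
  proof (rule ex_related_of_inj)
    show "inj_on (\<lambda>p. (last (side p), last (other_side p))) occurrences"
    proof (rule inj_onI)
      fix p q assume pq: "p \<in> occurrences" "q \<in> occurrences"
        "(last (side p), last (other_side p)) = (last (side q), last (other_side q))"
      obtain x y t z where p: "side p = [x, y]" "other_side p = [t, z]" "related (x, y) (t, z)"
        using occurrenceE[OF pq(1)] .
      obtain x' y' t' z' where q: "side q = [x', y']" "other_side q = [t', z']"
          "related (x', y') (t', z')"
        using occurrenceE[OF pq(2)] .
      have eq: "y' = y" "z' = z" using pq(3) p q by simp_all
      have "x = x'"
        using left_complement_unique[OF related_distinct(2)[OF p(3)] related_cong[OF p(3)]]
          related_cong[OF q(3)] eq by simp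
      then have "side p = side q" using p q eq by simp
      then show "p = q" using side_inj pq(1,2) by (meson inj_onD)
    qed
    fix p assume "p \<in> occurrences"
    then obtain x y t z where p: "side p = [x, y]" "other_side p = [t, z]" "related (x, y) (t, z)"
      by (rule occurrenceE)
    show "last (side p) \<noteq> last (other_side p)" "last (side p) \<in> X \<and> last (other_side p) \<in> X"
      using p related_distinct[OF p(3)] related_closed[OF p(3)] by simp_all
  qed (fact assms)+
  then obtain p where p: "p \<in> occurrences" "last (side p) = y" "last (other_side p) = z" by blast
  show ?thesis by (rule occurrenceE[OF p(1)]) (use p(2,3) in auto)
qed

text \<open>The words of length two that occur in no relation, one for each first letter, become the fixed
  points of \<open>S\<close>.\<close>

definition S :: "'a \<times> 'a \<Rightarrow> 'a \<times> 'a" where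
  "S p = (if \<exists>q. related p q then THE q. related p q else p)"

lemma S_related:
  assumes "related p q"
  shows "S p = q"
proof -
  have "(THE q. related p q) = q"
    using assms related_unique[OF _ assms] by (intro the_equality)
  moreover have "\<exists>q. related p q" using assms by blast
  ultimately show ?thesis by (simp only: S_def if_True)
qed

lemma S_cases: "related p (S p) \<or> S p = p"
proof (cases "\<exists>q. related p q")
  case True
  then show ?thesis using S_related by blast
qed (simp add: S_def)

lemma S_S: "S (S p) = p"
  using S_cases[of p]
proof
  assume "related p (S p)"
  then show ?thesis by (rule S_related[OF related_sym])
qed simp

lemma S_closed: "x \<in> X \<Longrightarrow> y \<in> X \<Longrightarrow> S (x, y) \<in> X \<times> X"
  using S_cases[of "(x, y)"] related_closed[of x y] by (cases "S (x, y)") auto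

lemma S_cong: "x \<in> X \<Longrightarrow> y \<in> X \<Longrightarrow> [x, y] \<approx> [fst (S (x, y)), snd (S (x, y))]"
  using S_cases[of "(x, y)"] related_cong[of x y] by (cases "S (x, y)") auto

lemma g_map_bij: "x \<in> X \<Longrightarrow> bij_betw (g_map S x) X X"
proof (rule bij_betw_of_unique_preimages[OF finite_X])
  fix t assume x: "x \<in> X" and t: "t \<in> X" "t \<noteq> x"
  obtain y z where yz: "related (x, y) (t, z)" using ex_related_first x t by metis
  have "y' = y" if "y' \<in> X" "g_map S x y' = t" for y'
  proof -
    define z' where "z' = snd (S (x, y'))"
    have "S (x, y') = (t, z')" using that by (simp add: z'_def g_map_def prod_eq_iff)
    then have "related (x, y') (t, z')" using S_cases[of "(x, y')"] t by simp
    from right_complement_unique[OF _ related_cong[OF this] related_cong[OF yz]]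
    show ?thesis using t by simp
  qed
  moreover have "y \<in> X" "g_map S x y = t"
    using related_closed[OF yz] S_related[OF yz] by (simp_all add: g_map_def)
  ultimately show "\<exists>!y. y \<in> X \<and> g_map S x y = t" by blast
next
  assume "x \<in> X"
  then show "g_map S x ` X \<subseteq> X"
    using S_closed by (auto simp: g_map_def mem_Times_iff)
qed

lemma f_map_bij: "y \<in> X \<Longrightarrow> bij_betw (f_map S y) X X"
proof (rule bij_betw_of_unique_preimages[OF finite_X])
  fix z assume y: "y \<in> X" and z: "z \<in> X" "z \<noteq> y"
  obtain x t where xt: "related (x, y) (t, z)" using ex_related_last y z by metis
  have "x' = x" if "x' \<in> X" "f_map S y x' = z" for x'
  proof -
    define t' where "t' = fst (S (x', y))"
    have "S (x', y) = (t', z)" using that by (simp add: t'_def f_map_def prod_eq_iff)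
    then have "related (x', y) (t', z)" using S_cases[of "(x', y)"] z by simp
    from left_complement_unique[OF _ related_cong[OF this] related_cong[OF xt]]
    show ?thesis using z by simp
  qed
  moreover have "x \<in> X" "f_map S y x = z"
    using related_closed[OF xt] S_related[OF xt] by (simp_all add: f_map_def)
  ultimately show "\<exists>!x. x \<in> X \<and> f_map S y x = z" by blast
next
  assume "y \<in> X"
  then show "f_map S y ` X \<subseteq> X"
    using S_closed by (auto simp: f_map_def mem_Times_iff)
qed

sublocale nondegenerate_involution X S
proof
  show "S ` (X \<times> X) \<subseteq> X \<times> X" using S_closed by (intro image_subsetI) (auto simp: mem_Times_iff)
  show "nondegenerate X S" using f_map_bij g_map_bij by (simp add: nondegenerate_def)
  show "involutive X S" by (simp add: involutive_def S_S)
qed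

lemma star_cong: "x \<in> X \<Longrightarrow> y \<in> X \<Longrightarrow> [x, star x y] \<approx> [y, star y x]"
  using S_cong[of x "star x y"] by (simp add: S_eq)

text \<open>Put \<open>a = star x y\<close>, \<open>b = star y x\<close>, \<open>c = star x z\<close> and \<open>d = star y z\<close>. The words
  \<open>x a (star a c)\<close> and \<open>y b (star b d)\<close> both represent minimal common right multiples of
  \<open>x a = y b\<close> and \<open>z\<close>, so their last letters agree.\<close>

lemma star_star_distinct:
  assumes X: "x \<in> X" "y \<in> X" "z \<in> X" and ne: "x \<noteq> y" "x \<noteq> z" "y \<noteq> z"
  shows "star (star x y) (star x z) = star (star y x) (star y z)"
proof -
  let ?a = "star x y" and ?b = "star y x" and ?c = "star x z" and ?d = "star y z"
  have multiple: "[u, star u v, star (star u v) (star u z)]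
      \<approx> [z, star z u, star (star u z) (star u v)]"
    if "u \<in> X" "v \<in> X" for u v
  proof -
    have "[u] @ [star u v, star (star u v) (star u z)] \<approx> [u] @ [star u z, star (star u z) (star u v)]"
      using that X star_cong by (intro cong_append) auto
    also have "\<dots> = [u, star u z] @ [star (star u z) (star u v)]" by simp
    also have "\<dots> \<approx> [z, star z u] @ [star (star u z) (star u v)]"
      using that X star_cong by (intro cong_append) auto
    finally show ?thesis by simp
  qed
  have xy: "[x, ?a] \<approx> [y, ?b]" using star_cong X by blast
  show ?thesis
  proof (rule minimal_right_multiple_unique)
    show "[z] \<in> lists X" using X by simp
    show "\<not> [x, ?a] \<approx> [z] @ s" for s
    proof
      assume z: "[x, ?a] \<approx> [z] @ s"
      then obtain e where "s = [e]"
        using cong_length[OF z] by (cases s) auto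
      \<comment> \<open>\<open>x a\<close> and \<open>x c\<close> are then both the lcm of \<open>x\<close> and \<open>z\<close>\<close>
      then have "?a = ?c"
        using z right_complement_unique[of x z ?a e ?c "star z x"] ne star_cong X by simp
      then show False using X ne by simp
    qed
    show "[x, ?a, star ?a ?c] \<approx> [x, ?a] @ [star ?a ?c]"
      using X by simp
    show "[x, ?a, star ?a ?c] \<approx> [z] @ [star z x, star ?c ?a]"
      using multiple[of x y] X by simp
    have "[y, ?b] @ [star ?b ?d] \<approx> [x, ?a] @ [star ?b ?d]"
      using xy X cong_sym by (intro cong_append) auto
    then show "[y, ?b, star ?b ?d] \<approx> [x, ?a] @ [star ?b ?d]" by simp
    show "[y, ?b, star ?b ?d] \<approx> [z] @ [star z y, star ?d ?b]"
      using multiple[of y x] X by simp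
  qed
qed

text \<open>With \<open>a = star x y\<close> and \<open>b = star y x\<close>, the maps \<open>z \<mapsto> star a (star x z)\<close> and
  \<open>z \<mapsto> star b (star y z)\<close> are permutations of \<open>X\<close> that agree outside \<open>{x, y}\<close> by the previous lemma.
  Hence they agree everywhere or differ by exchanging the values at \<open>x\<close> and \<open>y\<close>. The second case
  would give \<open>star a a = star b b\<close>, hence \<open>a = b\<close>, and then \<open>x = y\<close> by cancelling in \<open>x a = y b\<close>.\<close>

lemma star_star_degenerate:
  assumes X: "x \<in> X" "y \<in> X" and ne: "x \<noteq> y"
  shows "star (star x y) (star x x) = star (star y x) (star y x)"
proof -
  define a where "a = star x y"
  define b where "b = star y x"
  have ab: "a \<in> X" "b \<in> X" using X by (auto simp: a_def b_def)
  have "a \<noteq> b"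
  proof
    assume "a = b"
    then have "[x] @ [a] \<approx> [y] @ [a]" using star_cong[OF X] by (simp add: a_def b_def)
    then show False using cancel_right cong_letters ne by blast
  qed
  then have diag: "star a a \<noteq> star b b"
    using star_diagonal_inj ab by (auto dest: inj_onD)
  define h where "h z = star a (star x z)" for z
  define k where "k z = star b (star y z)" for z
  have inj: "inj_on h X" "inj_on k X" using X ab by (auto simp: inj_on_def h_def k_def)
  have "h ` X = X" "k ` X = X"
    using inj X ab by (intro endo_inj_surj finite_X image_subsetI; simp add: h_def k_def)+
  have "h ` {x, y} = k ` {x, y}"
  proof -
    have "h ` (X - {x, y}) = k ` (X - {x, y})"
      using star_star_distinct X ne by (intro image_cong) (auto simp: h_def k_def a_def b_def)
    moreover have "X - (X - {x, y}) = {x, y}" using X by blast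
    then have "h ` {x, y} = X - h ` (X - {x, y})" "k ` {x, y} = X - k ` (X - {x, y})"
      using X inj_on_image_set_diff[OF inj(1), of X "X - {x, y}"] \<open>h ` X = X\<close>
        inj_on_image_set_diff[OF inj(2), of X "X - {x, y}"] \<open>k ` X = X\<close> by simp_all
    ultimately show ?thesis by simp
  qed
  moreover have "h y = star a a" "k x = star b b" by (simp_all add: h_def k_def a_def b_def)
  ultimately have "h x = k x" using diag by (auto simp: doubleton_eq_iff)
  then show ?thesis by (simp add: h_def k_def a_def b_def)
qed

lemma cycle_law: cycle_law
  unfolding cycle_law_def
proof (intro ballI)
  fix x y z assume "x \<in> X" "y \<in> X" "z \<in> X"
  then show "star (star x y) (star x z) = star (star y x) (star y z)"
    using star_star_distinct[of x y z] star_star_degenerate[of x y] star_star_degenerate[of y x]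
    by (cases "x = y"; cases "x = z"; cases "y = z") auto
qed

text \<open>The structure relations of \<open>S\<close> are the relations of \<open>R\<close>, their converses and trivial ones.\<close>

lemma presented_group_eq: "presented_group X R = structure_group X S"
proof -
  let ?Y = "X \<times> (UNIV :: bool set)" and ?R = "structure_relations X S"
  have R: "\<exists>x y t z. r = ([x, y], [t, z]) \<and> x \<in> X \<and> y \<in> X \<and> S (x, y) = (t, z)" if rR: "r \<in> R" for r
  proof -
    obtain u v where "r = (u, v)" by fastforce
    moreover from this obtain x y t z where "u = [x, y]" "v = [t, z]"
      using quadratic[of u v] rR by (auto simp: numeral_2_eq_2 length_Suc_conv)
    ultimately have "r = ([x, y], [t, z])" "related (x, y) (t, z)" using rR by (auto simp: related_def)
    then show ?thesis using S_related related_closed by blast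
  qed
  then have "R \<subseteq> ?R" by (fastforce simp: structure_relations_def)
  then have "group_relations X R \<subseteq> group_relations X ?R" by (auto simp: group_relations_def)
  then have 1: "word_cong ?Y (group_relations X R) \<subseteq> word_cong ?Y (group_relations X ?R)"
    using word_cong.rel[of _ _ _ ?Y "[]" "[]"] by (intro word_cong_mono) auto
  have 2: "word_cong ?Y (group_relations X ?R) \<subseteq> word_cong ?Y (group_relations X R)"
  proof (rule word_cong_mono)
    fix u v assume uv: "(u, v) \<in> group_relations X ?R" "u \<in> lists ?Y" "v \<in> lists ?Y"
    have rel: "(u, v) \<in> word_cong ?Y (group_relations X R)"
      if "(u, v) \<in> group_relations X R" "u \<in> lists ?Y" "v \<in> lists ?Y" for u v
      using word_cong.rel[of _ _ _ ?Y "[]" "[]"] that by auto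
    show "(u, v) \<in> word_cong ?Y (group_relations X R)"
      using uv(1) unfolding group_relations_def[of X ?R]
    proof
      assume "(u, v) \<in> (\<lambda>(u, v). (map (\<lambda>x. (x, True)) u, map (\<lambda>x. (x, True)) v)) ` ?R"
      then obtain x y t z where r: "x \<in> X" "y \<in> X" "S (x, y) = (t, z)"
          "u = map (\<lambda>x. (x, True)) [x, y]" "v = map (\<lambda>x. (x, True)) [t, z]"
        by (auto simp: structure_relations_def)
      consider "related (x, y) (t, z)" | "u = v" using S_cases[of "(x, y)"] r by auto
      then show ?thesis
      proof cases
        case 1
        then have "(u, v) \<in> group_relations X R \<or> (v, u) \<in> group_relations X R"
          unfolding group_relations_def r related_def by force
        then show ?thesis using rel uv word_cong.sym by metis
      next
        case 2
        then show ?thesis using uv word_cong.refl by metis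
      qed
    next
      assume "(u, v) \<in> {([(x, b), (x, \<not> b)], []) |x b. x \<in> X}"
      then have "(u, v) \<in> group_relations X R" by (auto simp: group_relations_def)
      then show ?thesis using rel uv by blast
    qed
  qed
  show ?thesis
    using 1 2 by (simp add: structure_group_def presented_group_def presented_monoid_def subset_antisym)
qed

end

section \<open>Structure groups as Garside groups\<close>

theorem theoremA:
  "(\<forall>(X :: 'a set) S.
      finite X \<and> ybe_solution X S \<and> nondegenerate X S \<and> involutive X S
      \<longrightarrow> garside_group (structure_group X S)) \<and>
   (\<forall>(X :: 'a set) R n.
      R \<subseteq> lists X \<times> lists X \<and>
      garside_monoid (presented_monoid X R) \<and>
      n \<ge> 1 \<and> finite X \<and> card X = n \<and>
      card R = n * (n - 1) div 2 \<and>
      (\<forall>(u, v) \<in> R. length u = 2 \<and> length v = 2) \<and>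
      sides_appear_once R
      \<longrightarrow> (\<exists>S. ybe_solution X S \<and> nondegenerate X S \<and> involutive X S \<and>
            presented_group X R = structure_group X S))"
proof (intro conjI allI impI; elim conjE)
  fix X :: "'a set" and S
  assume "finite X" "ybe_solution X S" "nondegenerate X S" "involutive X S"
  then interpret nondegenerate_involution X S
    by unfold_locales (auto simp: ybe_solution_def bij_betw_def)
  interpret finite_cycle_set X S
    using \<open>finite X\<close> \<open>ybe_solution X S\<close>
    by unfold_locales (simp_all add: ybe_solution_def braided_iff_cycle_law)
  show "garside_group (structure_group X S)" by (rule garside_structure_group)
next
  fix X :: "'a set" and R and n :: nat
  assume "R \<subseteq> lists X \<times> lists X" "garside_monoid (presented_monoid X R)" "1 \<le> n" "finite X"
    "card X = n" "card R = n * (n - 1) div 2" "\<forall>(u, v) \<in> R. length u = 2 \<and> length v = 2"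
    "sides_appear_once R"
  then interpret quadratic_garside_presentation X R
    by unfold_locales auto
  have "bij_betw S (X \<times> X) (X \<times> X)"
    using S_S closed by (intro bij_betw_byWitness[of _ S]) auto
  moreover have "X \<noteq> {}" using \<open>1 \<le> n\<close> \<open>card X = n\<close> by auto
  ultimately have "ybe_solution X S"
    using braided_iff_cycle_law cycle_law by (simp add: ybe_solution_def)
  then show "\<exists>S. ybe_solution X S \<and> nondegenerate X S \<and> involutive X S \<and>
      presented_group X R = structure_group X S"
    using nondeg invol presented_group_eq by blast
qed


end
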